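(* Let $\Psi\in\mathcal B_0$ and $V\in L^\infty(\mathbb R^d)$. Suppose that $\mathcal D\subset\mathbb R^d$ is a convex (bounded or unbounded) domain of finite inradius, and let $\varphi$ be a weak sub-solution of $$H^{\mathcal D,V}\varphi\le0\ \text{ in }\mathcal D,\qquad\varphi\le0\ \text{ in }\mathcal D^c.$$ There exists a constant $\theta>0$, independent of $\Psi$ and $\mathcal D$, such that if $$\|V^-\|_{\infty,\mathcal D}-\inf_{\mathcal D}V^+<\theta\,\Psi([\operatorname{inrad}\mathcal D]^{-2}),$$ then $\varphi\le0$ in $\mathcal D$. Moreover, either $\varphi=0$ in $\mathcal D$ or $\varphi<0$ in $\mathcal D$.
   Context: $\mathcal B_0$ is the set of Bernstein functions $\Psi\in C^\infty((0,\infty))$ with $\Psi\ge0$, $(-1)^n\Psi^{(n)}\le0$ for all integers $n\ge1$, and $\lim_{u\downarrow0}\Psi(u)=0$. $(X_t)_{t\ge0}$ is the subordinate Brownian motion $X_t=B_{S_t}$ in $\mathbb R^d$, where $B$ is $d$-dimensional Brownian motion with $\mathbb E[e^{i\xi\cdot B_t}]=e^{-t|\xi|^2}$ and $S$ is an independent subordinator with $\mathbb E[e^{-uS_t}]=e^{-t\Psi(u)}$; $X$ is a Lévy process with generator $-\Psi(-\Delta)$. $\mathbb E^x$ is expectation for $X$ started at $x$, and $\tau_{\mathcal D}=\inf\{t>0: X_t\notin\mathcal D\}$. $H^{\mathcal D,V}=\Psi(-\Delta)+V$ on $\mathcal D$. A weak sub-solution of $H^{\mathcal D,V}\varphi\le0$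 in $\mathcal D$ is a function $\varphi\in C(\mathbb R^d)$ such that for every $t>0$ and $x\in\mathcal D$ $$\varphi(x)\le\mathbb E^x\big[e^{-\int_0^{t\wedge\tau_{\mathcal D}}V(X_s)\,ds}\varphi(X_{t\wedge\tau_{\mathcal D}})\big].$$ $V^+=\max(V,0)$ and $V^-=\max(-V,0)$; $\|\cdot\|_{\infty,\mathcal D}$ is the sup norm on $\mathcal D$; $\operatorname{inrad}\mathcal D$ is the supremum of the radii of balls contained in $\mathcal D$; $\mathcal D^c=\mathbb R^d\setminus\mathcal D$.
   Formalization: φ is also assumed bounded above on D (automatic for bounded D; e^x sin y on the strip R×(0,π) with Ψ(u)=u, V=0 refutes the claim otherwise), and the dichotomy φ=0 or φ<0 is claimed only for Ψ not identically 0 (it fails for Ψ=0, V=1). *)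

theory Defs
  imports "HOL-Probability.Probability"
begin

section \<open>Bernstein functions\<close>

text \<open>Only the values on the open half-line matter; \<open>(deriv ^^ n) \<Psi>\<close> is the \<open>n\<close>-th derivative,
  since each iterate is required to be differentiable at every point of the open set \<open>{0<..}\<close>.\<close>

definition bernstein0 :: "(real \<Rightarrow> real) \<Rightarrow> bool" where
  "bernstein0 \<Psi> \<longleftrightarrow>
     (\<forall>n. \<forall>u>0. (deriv ^^ n) \<Psi> field_differentiable (at u)) \<and>
     (\<forall>u>0. \<Psi> u \<ge> 0) \<and>
     (\<forall>n\<ge>1. \<forall>u>0. (- 1) ^ n * (deriv ^^ n) \<Psi> u \<le> 0) \<and>
     (\<Psi> \<longlongrightarrow> 0) (at_right 0)"

section \<open>Subordinate Brownian motion\<close>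

text \<open>Processes are indexed by \<open>real\<close>; only times \<open>t \<ge> 0\<close> are constrained.
  Path properties are required almost surely.\<close>

definition levy_process :: "'w measure \<Rightarrow> (real \<Rightarrow> 'w \<Rightarrow> 'b::euclidean_space) \<Rightarrow> bool" where
  "levy_process M X \<longleftrightarrow>
     prob_space M \<and>
     (\<forall>t\<ge>0. X t \<in> borel_measurable M) \<and>
     (AE \<omega> in M. X 0 \<omega> = 0) \<and>
     (\<forall>n. \<forall>t :: nat \<Rightarrow> real. 0 \<le> t 0 \<and> mono t \<longrightarrow>
        prob_space.indep_vars M (\<lambda>_. borel) (\<lambda>i \<omega>. X (t (Suc i)) \<omega> - X (t i) \<omega>) {..<n}) \<and>
     (\<forall>s\<ge>0. \<forall>h\<ge>0. distr M borel (\<lambda>\<omega>. X (s + h) \<omega> - X s \<omega>) = distr M borel (X h)) \<and>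
     (AE \<omega> in M. (\<forall>t\<ge>0. continuous (at_right t) (\<lambda>s. X s \<omega>)) \<and>
                 (\<forall>t>0. \<exists>l. ((\<lambda>s. X s \<omega>) \<longlongrightarrow> l) (at_left t)))"

text \<open>Normalised so that the generator is the Laplacian, not half of it.\<close>

definition brownian_motion :: "'w measure \<Rightarrow> (real \<Rightarrow> 'w \<Rightarrow> 'b::euclidean_space) \<Rightarrow> bool" where
  "brownian_motion M B \<longleftrightarrow>
     levy_process M B \<and>
     (AE \<omega> in M. continuous_on {0..} (\<lambda>t. B t \<omega>)) \<and>
     (\<forall>t\<ge>0. \<forall>\<xi>. (LINT \<omega>|M. iexp (\<xi> \<bullet> B t \<omega>)) = of_real (exp (- t * (norm \<xi>)\<^sup>2)))"

definition subordinator :: "'w measure \<Rightarrow> (real \<Rightarrow> 'w \<Rightarrow> real) \<Rightarrow> (real \<Rightarrow> real) \<Rightarrow> bool" where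
  "subordinator M S \<Psi> \<longleftrightarrow>
     levy_process M S \<and>
     (AE \<omega> in M. \<forall>s t. 0 \<le> s \<and> s \<le> t \<longrightarrow> S s \<omega> \<le> S t \<omega>) \<and>
     (\<forall>t\<ge>0. \<forall>u>0. (LINT \<omega>|M. exp (- u * S t \<omega>)) = exp (- t * \<Psi> u))"

text \<open>The probability space is complete, as is standard for exit times of a cadlag process
  to be random variables. Independence is that of the whole paths of \<open>B\<close> and \<open>S\<close>.\<close>

definition brownian_subordinator_pair ::
  "'w measure \<Rightarrow> (real \<Rightarrow> 'w \<Rightarrow> 'b::euclidean_space) \<Rightarrow> (real \<Rightarrow> 'w \<Rightarrow> real) \<Rightarrow> (real \<Rightarrow> real) \<Rightarrow> bool" where
  "brownian_subordinator_pair M B S \<Psi> \<longleftrightarrow>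
     complete_measure M \<and> brownian_motion M B \<and> subordinator M S \<Psi> \<and>
     prob_space.indep_set M
       (sets (vimage_algebra (space M) (\<lambda>\<omega>. \<lambda>t\<in>{0..}. B t \<omega>) (Pi\<^sub>M {0..} (\<lambda>_. borel))))
       (sets (vimage_algebra (space M) (\<lambda>\<omega>. \<lambda>t\<in>{0..}. S t \<omega>) (Pi\<^sub>M {0..} (\<lambda>_. borel))))"

definition subordinate :: "(real \<Rightarrow> 'w \<Rightarrow> 'b) \<Rightarrow> (real \<Rightarrow> 'w \<Rightarrow> real) \<Rightarrow> real \<Rightarrow> 'w \<Rightarrow> 'b" where
  "subordinate B S t \<omega> = B (S t \<omega>) \<omega>"

section \<open>Exit times and weak sub-solutions\<close>

text \<open>Below \<open>X\<close> starts at the origin, and the process started at \<open>x\<close> is \<open>x + X\<close>.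
  The exit time is \<open>\<infinity>\<close> when the process never leaves \<open>D\<close>.\<close>

definition exit_time :: "(real \<Rightarrow> 'w \<Rightarrow> 'b::euclidean_space) \<Rightarrow> 'b set \<Rightarrow> 'b \<Rightarrow> 'w \<Rightarrow> ereal" where
  "exit_time X D x \<omega> = Inf (ereal ` {t. 0 < t \<and> x + X t \<omega> \<notin> D})"

definition stopped_time :: "(real \<Rightarrow> 'w \<Rightarrow> 'b::euclidean_space) \<Rightarrow> 'b set \<Rightarrow> 'b \<Rightarrow> real \<Rightarrow> 'w \<Rightarrow> real" where
  "stopped_time X D x t \<omega> = real_of_ereal (min (ereal t) (exit_time X D x \<omega>))"

text \<open>The first conjunct under the quantifiers says that the expectation exists and is finite;
  it is needed because the Bochner integral of a non-integrable function is \<open>0\<close>.\<close>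

definition weak_subsolution ::
  "'w measure \<Rightarrow> (real \<Rightarrow> 'w \<Rightarrow> 'b::euclidean_space) \<Rightarrow> 'b set \<Rightarrow> ('b \<Rightarrow> real) \<Rightarrow> ('b \<Rightarrow> real) \<Rightarrow> bool" where
  "weak_subsolution M X D V \<phi> \<longleftrightarrow>
     continuous_on UNIV \<phi> \<and>
     (\<forall>t>0. \<forall>x\<in>D.
        let T = stopped_time X D x t;
            Z = (\<lambda>\<omega>. exp (- (LINT s:{0..T \<omega>}|lborel. V (x + X s \<omega>))) * \<phi> (x + X (T \<omega>) \<omega>))
        in integrable M Z \<and> \<phi> x \<le> (LINT \<omega>|M. Z \<omega>))"

section \<open>Potentials and domains\<close>

definition essinf :: "'b measure \<Rightarrow> ('b \<Rightarrow> ereal) \<Rightarrow> ereal" where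
  "essinf M f = - esssup M (\<lambda>x. - f x)"

text \<open>An element of \<open>L\<^sup>\<infinity>\<close> is given by a Borel representative, so that it can be evaluated
  along paths; its sup norm and infimum over a set are the essential ones, which do not depend on
  the representative.\<close>

definition L_infinity :: "('b::euclidean_space \<Rightarrow> real) \<Rightarrow> bool" where
  "L_infinity V \<longleftrightarrow> V \<in> borel_measurable borel \<and> esssup lborel (\<lambda>x. ereal \<bar>V x\<bar>) < \<infinity>"

definition sup_norm_on :: "'b::euclidean_space set \<Rightarrow> ('b \<Rightarrow> real) \<Rightarrow> ereal" where
  "sup_norm_on D f = esssup (restrict_space lborel D) (\<lambda>x. ereal \<bar>f x\<bar>)"

definition inf_on :: "'b::euclidean_space set \<Rightarrow> ('b \<Rightarrow> real) \<Rightarrow> ereal" where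
  "inf_on D f = essinf (restrict_space lborel D) (\<lambda>x. ereal (f x))"

definition pos_part :: "('b \<Rightarrow> real) \<Rightarrow> 'b \<Rightarrow> real" where
  "pos_part V x = max (V x) 0"

definition neg_part :: "('b \<Rightarrow> real) \<Rightarrow> 'b \<Rightarrow> real" where
  "neg_part V x = max (- V x) 0"

definition inscribed_radii :: "'b::metric_space set \<Rightarrow> real set" where
  "inscribed_radii D = {r. 0 < r \<and> (\<exists>x. ball x r \<subseteq> D)}"

text \<open>As a real supremum, \<open>inrad D\<close> is meaningful for nonempty open \<open>D\<close> with
  \<open>finite_inradius D\<close>.\<close>

definition finite_inradius :: "'b::metric_space set \<Rightarrow> bool" where
  "finite_inradius D \<longleftrightarrow> bdd_above (inscribed_radii D)"

definition inrad :: "'b::metric_space set \<Rightarrow> real" where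
  "inrad D = Sup (inscribed_radii D)"

end

theory Submission
  imports Defs
begin

text \<open>Let \<open>r\<close> be the inradius of \<open>D\<close>. For \<open>\<rho> > r\<close> and any \<open>x\<close>, the ball \<open>ball x \<rho>\<close> leaves the
  convex set \<open>D\<close>, so \<open>D\<close> lies in a half-space whose boundary passes within \<open>\<rho>\<close> of \<open>x\<close>. Since
  \<open>E cos (\<xi> \<bullet> X\<^sub>t) = exp (- t \<Psi> (|\<xi>|\<^sup>2))\<close> and \<open>X\<^sub>t\<close> is symmetric, at time \<open>t = 2 / \<Psi> (r\<^sup>-\<^sup>2)\<close> the
  process is outside that half-space with probability at least \<open>1 / 20\<close>. If \<open>K\<close> is the supremum of the
  positive part of the sub-solution, then \<open>\<phi> x \<le> K exp (\<gamma> t) P (x + X\<^sub>t \<in> D)\<close> with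
  \<open>\<gamma>\<close> the difference of the two norms of \<open>V\<close>, first for almost every \<open>x\<close> and then for all
  \<open>x\<close> by continuity; for \<open>\<theta> = 1 / 50\<close> this forces \<open>K = 0\<close>.

  For the dichotomy, once \<open>\<phi> \<le> 0\<close> the sub-solution inequality at a zero \<open>x\<close> shows that \<open>\<phi>\<close> vanishes
  almost surely at the stopped process. If \<open>\<phi>\<close> had both zeros and negative values in \<open>D\<close>, some ball on
  which \<open>\<phi> < 0\<close> would touch the zero set at a point \<open>x\<close>. Started at \<open>x\<close>, the process enters that ball
  with positive probability without leaving \<open>D\<close>: if \<open>S\<close> takes arbitrarily small positive values,
  because the ball looks like a half-space from \<open>x\<close>; otherwise by the first jump of \<open>S\<close>.\<close>

section \<open>Exit from convex sets\<close>

text \<open>The minimum with the finite time \<open>t\<close>, together with non-negativity of the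
  exit time, rules out the infinite values at which \<open>real_of_ereal\<close> returns 0.\<close>

lemma stopped_time_bounds:
  assumes "0 < t"
  shows "0 \<le> stopped_time X D x t \<omega>" "stopped_time X D x t \<omega> \<le> t"
    and "ereal (stopped_time X D x t \<omega>) = min (ereal t) (exit_time X D x \<omega>)"
proof -
  have "0 \<le> exit_time X D x \<omega>"
    unfolding exit_time_def by (rule INF_greatest) auto
  then have "\<bar>min (ereal t) (exit_time X D x \<omega>)\<bar> \<noteq> \<infinity>"
    using assms by (cases "exit_time X D x \<omega>") (auto simp: min_def)
  then show eq: "ereal (stopped_time X D x t \<omega>) = min (ereal t) (exit_time X D x \<omega>)"
    unfolding stopped_time_def by (simp add: ereal_real')
  have "0 \<le> ereal (stopped_time X D x t \<omega>)"
    unfolding eq using assms \<open>0 \<le> exit_time X D x \<omega>\<close> by simp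
  then show "0 \<le> stopped_time X D x t \<omega>" by simp
  have "ereal (stopped_time X D x t \<omega>) \<le> ereal t"
    unfolding eq by simp
  then show "stopped_time X D x t \<omega> \<le> t" by simp
qed

lemma in_domain_before_stopped_time:
  assumes "0 < s" "s < stopped_time X D x t \<omega>" "0 < t"
  shows "x + X s \<omega> \<in> D"
proof (rule ccontr)
  assume "x + X s \<omega> \<notin> D"
  then have "exit_time X D x \<omega> \<le> ereal s"
    unfolding exit_time_def using assms by (intro INF_lower) auto
  moreover have "ereal s < min (ereal t) (exit_time X D x \<omega>)"
    using stopped_time_bounds(3)[OF \<open>0 < t\<close>, of X D x \<omega>] assms(2) by (metis ereal_less_eq(3) not_le)
  ultimately show False by (auto dest: leD)
qed

text \<open>If the path were in \<open>D\<close> at the stopped time \<open>T < t\<close>, openness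
  and right continuity would keep it in \<open>D\<close> on some \<open>{T<..<b}\<close>, and the
  infimum defining the exit time would be at least \<open>b\<close>.\<close>

lemma outside_at_stopped_time:
  fixes X :: "real \<Rightarrow> 'w \<Rightarrow> 'b::euclidean_space"
  assumes "open D" "0 < t" "stopped_time X D x t \<omega> < t"
    and rc: "\<And>s. 0 \<le> s \<Longrightarrow> continuous (at_right s) (\<lambda>s. X s \<omega>)"
  shows "x + X (stopped_time X D x t \<omega>) \<omega> \<notin> D"
proof
  define T where "T = stopped_time X D x t \<omega>"
  assume "x + X (stopped_time X D x t \<omega>) \<omega> \<in> D"
  then have inD: "x + X T \<omega> \<in> D" by (simp add: T_def)
  have T: "0 \<le> T" "ereal T = exit_time X D x \<omega>"
    using stopped_time_bounds[OF \<open>0 < t\<close>, of X D x \<omega>] assms(3) unfolding T_def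
    by (auto simp: min_def split: if_splits)
  have "((\<lambda>s. x + X s \<omega>) \<longlongrightarrow> x + X T \<omega>) (at_right T)"
    using rc[OF T(1)] by (intro tendsto_intros) (simp add: continuous_within)
  then have "eventually (\<lambda>s. x + X s \<omega> \<in> D) (at_right T)"
    using \<open>open D\<close> inD by (rule topological_tendstoD)
  then obtain b where b: "b > T" "\<And>s. T < s \<Longrightarrow> s < b \<Longrightarrow> x + X s \<omega> \<in> D"
    unfolding eventually_at_right_field by blast
  have "ereal b \<le> exit_time X D x \<omega>"
    unfolding exit_time_def
  proof (rule INF_greatest)
    fix s assume s: "s \<in> {s. 0 < s \<and> x + X s \<omega> \<notin> D}"
    then have "exit_time X D x \<omega> \<le> ereal s"
      unfolding exit_time_def by (intro INF_lower)
    then have "T \<le> s" using T by (metis ereal_less_eq(3))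
    with s inD have "T < s" by (cases "T = s") auto
    with b s show "ereal b \<le> ereal s" by (metis ereal_less_eq(3) mem_Collect_eq not_le)
  qed
  with T b show False by (metis ereal_less_eq(3) not_le)
qed

section \<open>Inradius, bounding half-spaces and touching balls\<close>

lemma inrad_pos:
  fixes D :: "'b::metric_space set"
  assumes "open D" "D \<noteq> {}" "finite_inradius D"
  shows "0 < inrad D"
proof -
  obtain x r where "0 < r" "ball x r \<subseteq> D"
    using assms(1,2) by (meson equals0I open_contains_ball)
  then have "r \<le> inrad D"
    using assms(3) unfolding inrad_def finite_inradius_def
    by (intro cSup_upper) (auto simp: inscribed_radii_def)
  with \<open>0 < r\<close> show ?thesis by simp
qed

text \<open>A ball whose radius \<open>\<rho>\<close> exceeds the inradius contains a point
  \<open>z\<close> outside \<open>D\<close>. A hyperplane separating \<open>z\<close> from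
  \<open>D\<close> has unit normal \<open>a\<close>, and Cauchy-Schwarz bounds
  \<open>a \<bullet> (z - x)\<close>. The strict gap matters because a ball of radius exactly
  \<open>inrad D\<close> may fit inside \<open>D\<close>.\<close>

lemma convex_in_near_halfspace:
  fixes D :: "'b::euclidean_space set"
  assumes "open D" "D \<noteq> {}" "convex D" "finite_inradius D" "inrad D < \<rho>"
  obtains a where "norm a = 1" "\<And>y. y \<in> D \<Longrightarrow> a \<bullet> (y - x) < \<rho>"
proof -
  have "0 < \<rho>" using inrad_pos[OF assms(1,2,4)] assms(5) by simp
  have "\<not> ball x \<rho> \<subseteq> D"
  proof
    assume "ball x \<rho> \<subseteq> D"
    then have "\<rho> \<le> inrad D"
      using assms(4) \<open>0 < \<rho>\<close> unfolding inrad_def finite_inradius_def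
      by (intro cSup_upper) (auto simp: inscribed_radii_def)
    with assms(5) show False by simp
  qed
  then obtain z where z: "dist x z < \<rho>" "z \<notin> D" by (auto simp: subset_eq)
  obtain a b where ab: "a \<noteq> 0" "\<forall>y\<in>D. a \<bullet> y \<le> b" "a \<bullet> z \<ge> b"
    using separating_hyperplane_sets[of D "{z}"] assms(2,3) z(2) by auto
  define a' where "a' = a /\<^sub>R norm a"
  have n: "norm a' = 1" using ab(1) by (simp add: a'_def)
  show thesis
  proof (rule that[OF n])
    fix y assume "y \<in> D"
    then have "a \<bullet> y \<le> a \<bullet> z" using ab by force
    then have "a' \<bullet> y \<le> a' \<bullet> z"
      by (simp add: a'_def divide_right_mono divide_inverse_commute[symmetric])
    then have "a' \<bullet> (y - x) \<le> a' \<bullet> (z - x)" by (simp add: inner_diff_right)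
    also have "\<dots> \<le> norm a' * norm (z - x)" by (rule norm_cauchy_schwarz)
    also have "\<dots> < \<rho>" using z(1) n by (simp add: dist_norm norm_minus_commute)
    finally show "a' \<bullet> (y - x) < \<rho>" .
  qed
qed

text \<open>By connectedness the relatively closed set \<open>A\<close> is not open, so some
  \<open>p\<close> in \<open>A\<close> has points \<open>c\<close> outside \<open>A\<close>
  arbitrarily near. Growing a ball around such a \<open>c\<close> until it meets \<open>A\<close>
  gives the contact point \<open>x\<close>.\<close>

lemma touching_ball:
  fixes D :: "'b::euclidean_space set"
  assumes "open D" "connected D" "A \<subseteq> D" "open (D - A)" "A \<noteq> {}" "A \<noteq> D"
  obtains c \<rho> x where "x \<in> A" "0 < \<rho>" "dist c x = \<rho>" "ball c \<rho> \<subseteq> D - A"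
proof -
  have "\<not> open A"
  proof
    assume "open A"
    then have "A \<inter> D = {} \<or> (D - A) \<inter> D = {}"
      using assms by (intro connectedD[OF assms(2)]) auto
    then show False using assms by auto
  qed
  then obtain p where p: "p \<in> A" "\<And>e. 0 < e \<Longrightarrow> \<not> ball p e \<subseteq> A"
    by (auto simp: open_contains_ball)
  obtain R where R: "0 < R" "cball p R \<subseteq> D"
    using assms(1,3) p(1) by (meson open_contains_cball subsetD)
  have "\<not> ball p (R / 2) \<subseteq> A" using p(2) R(1) by simp
  then obtain c where c: "dist p c < R / 2" "c \<notin> A" by (auto simp: subset_eq)
  \<comment> \<open>\<open>A\<close> is closed only relative to \<open>D\<close>; cutting with
    \<open>cball p R\<close> makes it compact. Since \<open>c\<close> is within \<open>R / 2\<close>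
    of \<open>p\<close>, the ball around \<open>c\<close> up to the nearest point of
    \<open>K\<close> stays inside \<open>cball p R\<close>, so it misses all of
    \<open>A\<close>.\<close>
  define K where "K = cball p R - (D - A)"
  have K: "K = cball p R \<inter> A" using R(2) by (auto simp: K_def)
  have "compact K" unfolding K_def using assms(4) by (intro compact_diff) auto
  moreover have "p \<in> K" using p(1) R(1) by (simp add: K)
  ultimately obtain x where x: "x \<in> K" "\<And>y. y \<in> K \<Longrightarrow> dist c x \<le> dist c y"
    using distance_attains_inf[of K c] compact_imp_closed by blast
  have le: "dist c x < R / 2" using x(2)[OF \<open>p \<in> K\<close>] c(1) by (simp add: dist_commute)
  show thesis
  proof (rule that[of x "dist c x" c])
    show "x \<in> A" using x(1) by (simp add: K)
    then show "0 < dist c x" using c(2) by auto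
    show "ball c (dist c x) \<subseteq> D - A"
    proof
      fix y assume y: "y \<in> ball c (dist c x)"
      have "dist p y \<le> dist p c + dist c y" by (rule dist_triangle)
      then have yR: "y \<in> cball p R" using y c(1) le by simp
      have "y \<notin> K" using x(2)[of y] y by auto
      with yR R(2) show "y \<in> D - A" by (auto simp: K)
    qed
  qed simp
qed

section \<open>Gaussian vectors\<close>

lemma (in prob_space) integrable_bounded:
  fixes f :: "'a \<Rightarrow> real"
  assumes "f \<in> borel_measurable M" "\<And>\<omega>. \<bar>f \<omega>\<bar> \<le> C"
  shows "integrable M f"
  using assms by (intro integrable_const_bound[where B=C]) auto

text \<open>Allows characteristic functions to be handled through real cosine and sine moments; the
  weight \<open>W\<close> covers changes of density.\<close>

lemma (in prob_space) integral_iexp_eq: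
  fixes Y W :: "'a \<Rightarrow> real"
  assumes [measurable]: "Y \<in> borel_measurable M" "W \<in> borel_measurable M"
    and "\<And>\<omega>. \<bar>W \<omega>\<bar> \<le> C"
  shows "(LINT \<omega>|M. W \<omega> *\<^sub>R iexp (Y \<omega>)) =
    Complex (LINT \<omega>|M. W \<omega> * cos (Y \<omega>)) (LINT \<omega>|M. W \<omega> * sin (Y \<omega>))"
proof -
  have "integrable M (\<lambda>\<omega>. W \<omega> *\<^sub>R iexp (Y \<omega>))"
    using assms(3) by (intro integrable_const_bound[where B=C]) auto
  from integral_Re[OF this] integral_Im[OF this] show ?thesis
    by (intro complex_eqI) (simp_all add: cos_of_real sin_of_real Re_exp Im_exp)
qed

text \<open>Normalised to mean 1, the weight is a density under which \<open>Y\<close> keeps its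
  characteristic function, hence its law. This passes from factorisation at all frequencies to
  factorisation on Borel sets.\<close>

lemma (in prob_space) weighted_Levy_uniqueness:
  fixes Y W :: "'a \<Rightarrow> real"
  assumes [measurable]: "Y \<in> borel_measurable M" "W \<in> borel_measurable M" "A \<in> sets borel"
    and W: "\<And>\<omega>. 0 \<le> W \<omega>" "\<And>\<omega>. W \<omega> \<le> C"
    and cos: "\<And>b. expectation (\<lambda>\<omega>. W \<omega> * cos (b * Y \<omega>)) = c * expectation (\<lambda>\<omega>. cos (b * Y \<omega>))"
    and sin: "\<And>b. expectation (\<lambda>\<omega>. W \<omega> * sin (b * Y \<omega>)) = c * expectation (\<lambda>\<omega>. sin (b * Y \<omega>))"
  shows "expectation (\<lambda>\<omega>. W \<omega> * indicator A (Y \<omega>)) = c * expectation (\<lambda>\<omega>. indicator A (Y \<omega>))"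
proof -
  have Wabs: "\<bar>W \<omega>\<bar> \<le> C" for \<omega> using W by simp
  have intW: "integrable M W" by (rule integrable_bounded[OF _ Wabs]) simp
  \<comment> \<open>Frequency 0 identifies the constant as the mean of the weight.\<close>
  have c: "c = expectation W" using cos[of 0] by (simp add: prob_space)
  then have "0 \<le> c" using W(1) by (simp add: integral_nonneg_AE)
  show ?thesis
  proof (cases "c = 0")
    case True
    then have "AE \<omega> in M. W \<omega> = 0"
      using integral_nonneg_eq_0_iff_AE[OF intW] W(1) c by auto
    then have "AE \<omega> in M. W \<omega> * indicator A (Y \<omega>) = 0" by eventually_elim simp
    then have "expectation (\<lambda>\<omega>. W \<omega> * indicator A (Y \<omega>)) = 0"
      by (rule integral_eq_zero_AE)
    with True show ?thesis by simp
  next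
    case False
    with \<open>0 \<le> c\<close> have "0 < c" by simp
    define Q where "Q = density M (\<lambda>\<omega>. ennreal (W \<omega> / c))"
    have nn: "AE \<omega> in M. 0 \<le> W \<omega> / c" using W(1) \<open>0 < c\<close> by simp
    have "emeasure Q (space Q) = (\<integral>\<^sup>+\<omega>. ennreal (W \<omega> / c) \<partial>M)"
      by (simp add: Q_def emeasure_density cong: nn_integral_cong)
    also have "\<dots> = ennreal (expectation (\<lambda>\<omega>. W \<omega> / c))"
      using intW nn by (intro nn_integral_eq_integral) auto
    also have "\<dots> = 1" using c False by simp
    finally interpret Q: prob_space Q by (rule prob_spaceI)
    have [measurable_cong]: "sets Q = sets M" by (simp add: Q_def)
    have "char (distr Q borel Y) b = char (distr M borel Y) b" for b
    proof -
      have "char (distr Q borel Y) b = (CLINT \<omega>|Q. iexp (b * Y \<omega>))"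
        unfolding char_def by (subst integral_distr) (auto simp: mult.commute)
      also have "\<dots> = (CLINT \<omega>|M. (W \<omega> / c) *\<^sub>R iexp (b * Y \<omega>))"
        unfolding Q_def using nn by (subst integral_density) auto
      also have "\<dots> = Complex (LINT \<omega>|M. W \<omega> / c * cos (b * Y \<omega>)) (LINT \<omega>|M. W \<omega> / c * sin (b * Y \<omega>))"
        using W \<open>0 < c\<close> Wabs
        by (intro integral_iexp_eq[where C="C / c"]) (auto simp: divide_right_mono)
      also have "\<dots> = Complex (LINT \<omega>|M. 1 * cos (b * Y \<omega>)) (LINT \<omega>|M. 1 * sin (b * Y \<omega>))"
        using cos[of b] sin[of b] False by simp
      also have "\<dots> = (CLINT \<omega>|M. 1 *\<^sub>R iexp (b * Y \<omega>))"
        by (intro integral_iexp_eq[where C=1, symmetric]) auto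
      also have "\<dots> = char (distr M borel Y) b"
        unfolding char_def by (subst integral_distr) (auto simp: mult.commute)
      finally show ?thesis .
    qed
    then have eq: "distr Q borel Y = distr M borel Y"
      by (intro Levy_uniqueness Q.real_distribution_distr real_distribution_distr ext) auto
    have "expectation (\<lambda>\<omega>. (W \<omega> / c) *\<^sub>R indicat_real A (Y \<omega>)) = (LINT \<omega>|Q. indicat_real A (Y \<omega>))"
      unfolding Q_def using nn by (subst integral_density) auto
    also have "\<dots> = (LINT x|distr Q borel Y. indicator A x)"
      by (subst integral_distr) auto
    also have "\<dots> = expectation (\<lambda>\<omega>. indicator A (Y \<omega>))"
      unfolding eq by (subst integral_distr) auto
    finally show ?thesis using False by (simp add: field_simps)
  qed
qed

text \<open>A centred Gaussian vector with covariance \<open>2 s\<close> times the identity, given by its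
  characteristic function.\<close>

locale isotropic_gaussian = prob_space +
  fixes Y :: "'a \<Rightarrow> 'b::euclidean_space" and s :: real
  assumes Y[measurable]: "Y \<in> borel_measurable M" and s_pos: "0 < s"
    and expectation_cos: "expectation (\<lambda>\<omega>. cos (\<xi> \<bullet> Y \<omega>)) = exp (- s * (norm \<xi>)\<^sup>2)"
    and expectation_sin: "expectation (\<lambda>\<omega>. sin (\<xi> \<bullet> Y \<omega>)) = 0"
begin

text \<open>The component along a unit vector has variance \<open>2 * s\<close>; rescaling its
  frequency by \<open>sqrt (2 * s)\<close> turns \<open>exp (- s * (norm \<xi>)\<^sup>2)\<close>
  into the standard normal characteristic function.\<close>

lemma distr_marginal:
  assumes e: "norm e = 1"
  shows "distr M borel (\<lambda>\<omega>. (e \<bullet> Y \<omega>) / sqrt (2 * s)) = std_normal_distribution"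
proof (rule Levy_uniqueness)
  show "real_distribution (distr M borel (\<lambda>\<omega>. (e \<bullet> Y \<omega>) / sqrt (2 * s)))"
    by (rule real_distribution_distr) simp
  show "real_distribution std_normal_distribution" by (rule real_dist_normal_dist)
  show "char (distr M borel (\<lambda>\<omega>. (e \<bullet> Y \<omega>) / sqrt (2 * s))) = char std_normal_distribution"
  proof
    fix b
    define \<xi> where "\<xi> = (b / sqrt (2 * s)) *\<^sub>R e"
    have "char (distr M borel (\<lambda>\<omega>. (e \<bullet> Y \<omega>) / sqrt (2 * s))) b =
        (CLINT \<omega>|M. 1 *\<^sub>R iexp (\<xi> \<bullet> Y \<omega>))"
      unfolding char_def \<xi>_def by (subst integral_distr) (auto simp: mult.commute)
    also have "\<dots> = Complex (LINT \<omega>|M. 1 * cos (\<xi> \<bullet> Y \<omega>)) (LINT \<omega>|M. 1 * sin (\<xi> \<bullet> Y \<omega>))"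
      by (rule integral_iexp_eq[where C=1]) auto
    also have "\<dots> = complex_of_real (exp (- s * (norm \<xi>)\<^sup>2))"
      by (simp add: expectation_cos expectation_sin complex_of_real_def)
    also have "(norm \<xi>)\<^sup>2 = b\<^sup>2 / (2 * s)"
      using s_pos e by (simp add: \<xi>_def power_divide)
    also have "- s * (b\<^sup>2 / (2 * s)) = - (b\<^sup>2) / 2" using s_pos by simp
    finally show "char (distr M borel (\<lambda>\<omega>. (e \<bullet> Y \<omega>) / sqrt (2 * s))) b = char std_normal_distribution b"
      by (simp add: char_std_normal_distribution)
  qed
qed

lemma prob_marginal:
  assumes "norm e = 1" and [measurable]: "A \<in> sets borel"
  shows "prob {\<omega>\<in>space M. (e \<bullet> Y \<omega>) / sqrt (2 * s) \<in> A} = measure std_normal_distribution A"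
proof -
  have "measure (distr M borel (\<lambda>\<omega>. (e \<bullet> Y \<omega>) / sqrt (2 * s))) A =
      prob ((\<lambda>\<omega>. (e \<bullet> Y \<omega>) / sqrt (2 * s)) -` A \<inter> space M)"
    by (rule measure_distr) auto
  then show ?thesis
    unfolding distr_marginal[OF assms(1)]
    by (auto intro!: arg_cong[where f=prob])
qed

text \<open>Coordinates are converted one at a time from frequencies to Borel sets. The free
  frequency \<open>\<xi>\<close>, orthogonal to those already converted, keeps the induction
  hypothesis strong enough to absorb the next one.\<close>

lemma coordinates_independent_aux:
  assumes "finite I" "I \<subseteq> Basis" and A: "\<And>i. A i \<in> sets borel"
  shows "\<And>\<xi>. (\<And>i. i \<in> I \<Longrightarrow> \<xi> \<bullet> i = 0) \<Longrightarrow>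
     expectation (\<lambda>\<omega>. (\<Prod>i\<in>I. indicator (A i) (i \<bullet> Y \<omega>)) * cos (\<xi> \<bullet> Y \<omega>)) =
       (\<Prod>i\<in>I. expectation (\<lambda>\<omega>. indicator (A i) (i \<bullet> Y \<omega>))) * exp (- s * (norm \<xi>)\<^sup>2) \<and>
     expectation (\<lambda>\<omega>. (\<Prod>i\<in>I. indicator (A i) (i \<bullet> Y \<omega>)) * sin (\<xi> \<bullet> Y \<omega>)) = 0"
  using assms(1,2)
proof (induction I rule: finite_induct)
  case empty
  then show ?case using expectation_cos expectation_sin by simp
next
  case (insert j I)
  note [measurable] = A
  define P where "P \<omega> = (\<Prod>i\<in>I. indicator (A i) (i \<bullet> Y \<omega>) :: real)" for \<omega>
  define p where "p = (\<Prod>i\<in>I. expectation (\<lambda>\<omega>. indicator (A i) (i \<bullet> Y \<omega>) :: real))"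
  define q where "q = expectation (\<lambda>\<omega>. indicator (A j) (j \<bullet> Y \<omega>) :: real)"
  define E where "E = exp (- s * (norm \<xi>)\<^sup>2)"
  have P01: "0 \<le> P \<omega>" "P \<omega> \<le> 1" for \<omega>
    unfolding P_def by (auto intro!: prod_nonneg prod_le_1)
  have [measurable]: "P \<in> borel_measurable M" unfolding P_def by measurable
  \<comment> \<open>Weights must be non-negative to act as densities, so 1 is added to the cosine
    and the sine and its contribution is subtracted at the end.\<close>
  have cs: "0 \<le> 1 + cos x" "0 \<le> 1 + sin x" for x :: real
    using cos_ge_minus_one[of x] sin_ge_minus_one[of x] by linarith+
  have Pint: "integrable M (\<lambda>\<omega>. P \<omega> * f \<omega>)" if [measurable]: "f \<in> borel_measurable M"
    and "\<And>\<omega>. \<bar>f \<omega>\<bar> \<le> 1" for f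
  proof (rule integrable_bounded[where C=1])
    show "\<bar>P \<omega> * f \<omega>\<bar> \<le> 1" for \<omega>
      using mult_mono[of "\<bar>P \<omega>\<bar>" 1 "\<bar>f \<omega>\<bar>" 1] that(2)[of \<omega>] P01[of \<omega>] by (simp add: abs_mult)
  qed simp
  have j: "j \<in> Basis" "j \<notin> I" "I \<subseteq> Basis" using insert by auto
  then have jI: "j \<bullet> i = 0" if "i \<in> I" for i using that by (auto simp: inner_Basis)
  have \<xi>j: "\<xi> \<bullet> j = 0" and \<xi>I: "\<And>i. i \<in> I \<Longrightarrow> \<xi> \<bullet> i = 0" using insert.prems by auto
  have C: "expectation (\<lambda>\<omega>. P \<omega> * cos (\<eta> \<bullet> Y \<omega>)) = p * exp (- s * (norm \<eta>)\<^sup>2)"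
    and Sn: "expectation (\<lambda>\<omega>. P \<omega> * sin (\<eta> \<bullet> Y \<omega>)) = 0"
    if "\<And>i. i \<in> I \<Longrightarrow> \<eta> \<bullet> i = 0" for \<eta>
    using insert.IH[of \<eta>] that j(3) unfolding P_def p_def by auto
  \<comment> \<open>Orthogonality of \<open>\<xi>\<close> and \<open>j\<close> splits the squared
    norm, so the Gaussian exponential factorises as \<open>E * Eb b\<close>.\<close>
  have nb: "(norm (b *\<^sub>R j))\<^sup>2 = b\<^sup>2"
    and np: "(norm (\<xi> + b *\<^sub>R j))\<^sup>2 = (norm \<xi>)\<^sup>2 + b\<^sup>2"
    and nm: "(norm (\<xi> - b *\<^sub>R j))\<^sup>2 = (norm \<xi>)\<^sup>2 + b\<^sup>2" for b
    using j(1) \<xi>j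
    by (simp_all only: power2_norm_eq_inner inner_simps inner_commute[of j \<xi>])
      (simp_all add: power2_eq_square)
  define Eb where "Eb b = exp (- s * b\<^sup>2)" for b
  have EE: "exp (- s * ((norm \<xi>)\<^sup>2 + b\<^sup>2)) = E * Eb b" for b
    by (simp add: E_def Eb_def exp_add[symmetric] algebra_simps)
  have marg: "expectation (\<lambda>\<omega>. cos (b * (j \<bullet> Y \<omega>))) = Eb b"
      "expectation (\<lambda>\<omega>. sin (b * (j \<bullet> Y \<omega>))) = 0" for b
    using expectation_cos[of "b *\<^sub>R j"] expectation_sin[of "b *\<^sub>R j"] j(1) by (auto simp: Eb_def)
  have c0: "expectation (\<lambda>\<omega>. P \<omega> * cos (b * (j \<bullet> Y \<omega>))) = p * Eb b"
    and s0: "expectation (\<lambda>\<omega>. P \<omega> * sin (b * (j \<bullet> Y \<omega>))) = 0" for b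
    using C[of "b *\<^sub>R j"] Sn[of "b *\<^sub>R j"] jI unfolding nb Eb_def by auto
  have cp: "expectation (\<lambda>\<omega>. P \<omega> * cos (\<xi> \<bullet> Y \<omega> + b * (j \<bullet> Y \<omega>))) = p * (E * Eb b)"
    and sp: "expectation (\<lambda>\<omega>. P \<omega> * sin (\<xi> \<bullet> Y \<omega> + b * (j \<bullet> Y \<omega>))) = 0"
    and cm: "expectation (\<lambda>\<omega>. P \<omega> * cos (\<xi> \<bullet> Y \<omega> - b * (j \<bullet> Y \<omega>))) = p * (E * Eb b)"
    and sm: "expectation (\<lambda>\<omega>. P \<omega> * sin (\<xi> \<bullet> Y \<omega> - b * (j \<bullet> Y \<omega>))) = 0" for b
    using C[of "\<xi> + b *\<^sub>R j"] Sn[of "\<xi> + b *\<^sub>R j"] C[of "\<xi> - b *\<^sub>R j"] Sn[of "\<xi> - b *\<^sub>R j"] \<xi>I jI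
    unfolding np nm EE by (simp_all add: inner_simps)
  have split: "expectation (\<lambda>\<omega>. P \<omega> * f \<omega> + (P \<omega> * g \<omega> + P \<omega> * h \<omega>) / 2) =
      expectation (\<lambda>\<omega>. P \<omega> * f \<omega>) + (expectation (\<lambda>\<omega>. P \<omega> * g \<omega>) + expectation (\<lambda>\<omega>. P \<omega> * h \<omega>)) / 2"
    if "f \<in> borel_measurable M" "g \<in> borel_measurable M" "h \<in> borel_measurable M"
      "\<And>\<omega>. \<bar>f \<omega>\<bar> \<le> 1" "\<And>\<omega>. \<bar>g \<omega>\<bar> \<le> 1" "\<And>\<omega>. \<bar>h \<omega>\<bar> \<le> 1" for f g h
    using Pint[of f] Pint[of g] Pint[of h] that by simp
  have w0: "expectation (\<lambda>\<omega>. P \<omega> * indicator (A j) (j \<bullet> Y \<omega>)) = p * q"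
    unfolding q_def using P01
    by (intro weighted_Levy_uniqueness[where C=1]) (auto simp: c0 s0 marg)
  \<comment> \<open>Product-to-sum formulas reduce the moments of this weight to the induction
    hypothesis at the frequencies \<open>\<xi> + b *\<^sub>R j\<close> and
    \<open>\<xi> - b *\<^sub>R j\<close>.\<close>
  have w1: "expectation (\<lambda>\<omega>. (P \<omega> * (1 + cos (\<xi> \<bullet> Y \<omega>))) * indicator (A j) (j \<bullet> Y \<omega>)) = (p * (1 + E)) * q"
    unfolding q_def
  proof (intro weighted_Levy_uniqueness[where C=2])
    show "0 \<le> P \<omega> * (1 + cos (\<xi> \<bullet> Y \<omega>))" for \<omega>
      by (intro mult_nonneg_nonneg P01 cs)
    show "P \<omega> * (1 + cos (\<xi> \<bullet> Y \<omega>)) \<le> 2" for \<omega>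
    proof -
      have "P \<omega> * (1 + cos (\<xi> \<bullet> Y \<omega>)) \<le> 1 * (1 + 1)"
        using P01[of \<omega>] by (intro mult_mono add_left_mono cos_le_one cs) auto
      then show ?thesis by simp
    qed
    fix b
    have "expectation (\<lambda>\<omega>. P \<omega> * (1 + cos (\<xi> \<bullet> Y \<omega>)) * cos (b * (j \<bullet> Y \<omega>))) =
      expectation (\<lambda>\<omega>. P \<omega> * cos (b * (j \<bullet> Y \<omega>)) +
        (P \<omega> * cos (\<xi> \<bullet> Y \<omega> - b * (j \<bullet> Y \<omega>)) + P \<omega> * cos (\<xi> \<bullet> Y \<omega> + b * (j \<bullet> Y \<omega>))) / 2)"
      by (intro Bochner_Integration.integral_cong refl) (simp add: cos_add cos_diff algebra_simps)
    also have "\<dots> = p * (1 + E) * expectation (\<lambda>\<omega>. cos (b * (j \<bullet> Y \<omega>)))"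
      by (subst split) (auto simp: c0 cp cm marg algebra_simps)
    finally show "expectation (\<lambda>\<omega>. P \<omega> * (1 + cos (\<xi> \<bullet> Y \<omega>)) * cos (b * (j \<bullet> Y \<omega>))) =
      p * (1 + E) * expectation (\<lambda>\<omega>. cos (b * (j \<bullet> Y \<omega>)))" .
    have "expectation (\<lambda>\<omega>. P \<omega> * (1 + cos (\<xi> \<bullet> Y \<omega>)) * sin (b * (j \<bullet> Y \<omega>))) =
      expectation (\<lambda>\<omega>. P \<omega> * sin (b * (j \<bullet> Y \<omega>)) +
        (P \<omega> * (- sin (\<xi> \<bullet> Y \<omega> - b * (j \<bullet> Y \<omega>))) + P \<omega> * sin (\<xi> \<bullet> Y \<omega> + b * (j \<bullet> Y \<omega>))) / 2)"
      by (intro Bochner_Integration.integral_cong refl) (simp add: sin_add sin_diff algebra_simps)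
    also have "\<dots> = p * (1 + E) * expectation (\<lambda>\<omega>. sin (b * (j \<bullet> Y \<omega>)))"
      by (subst split) (auto simp: s0 sp sm marg)
    finally show "expectation (\<lambda>\<omega>. P \<omega> * (1 + cos (\<xi> \<bullet> Y \<omega>)) * sin (b * (j \<bullet> Y \<omega>))) =
      p * (1 + E) * expectation (\<lambda>\<omega>. sin (b * (j \<bullet> Y \<omega>)))" .
  qed auto
  \<comment> \<open>The sine term has mean zero against \<open>P\<close>, so the factor is
    \<open>p\<close> alone.\<close>
  have w2: "expectation (\<lambda>\<omega>. (P \<omega> * (1 + sin (\<xi> \<bullet> Y \<omega>))) * indicator (A j) (j \<bullet> Y \<omega>)) = p * q"
    unfolding q_def
  proof (intro weighted_Levy_uniqueness[where C=2])
    show "0 \<le> P \<omega> * (1 + sin (\<xi> \<bullet> Y \<omega>))" for \<omega>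
      by (intro mult_nonneg_nonneg P01 cs)
    show "P \<omega> * (1 + sin (\<xi> \<bullet> Y \<omega>)) \<le> 2" for \<omega>
    proof -
      have "P \<omega> * (1 + sin (\<xi> \<bullet> Y \<omega>)) \<le> 1 * (1 + 1)"
        using P01[of \<omega>] by (intro mult_mono add_left_mono sin_le_one cs) auto
      then show ?thesis by simp
    qed
    fix b
    have "expectation (\<lambda>\<omega>. P \<omega> * (1 + sin (\<xi> \<bullet> Y \<omega>)) * cos (b * (j \<bullet> Y \<omega>))) =
      expectation (\<lambda>\<omega>. P \<omega> * cos (b * (j \<bullet> Y \<omega>)) +
        (P \<omega> * sin (\<xi> \<bullet> Y \<omega> - b * (j \<bullet> Y \<omega>)) + P \<omega> * sin (\<xi> \<bullet> Y \<omega> + b * (j \<bullet> Y \<omega>))) / 2)"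
      by (intro Bochner_Integration.integral_cong refl) (simp add: sin_add sin_diff algebra_simps)
    also have "\<dots> = p * expectation (\<lambda>\<omega>. cos (b * (j \<bullet> Y \<omega>)))"
      by (subst split) (auto simp: c0 sp sm marg)
    finally show "expectation (\<lambda>\<omega>. P \<omega> * (1 + sin (\<xi> \<bullet> Y \<omega>)) * cos (b * (j \<bullet> Y \<omega>))) =
      p * expectation (\<lambda>\<omega>. cos (b * (j \<bullet> Y \<omega>)))" .
    have "expectation (\<lambda>\<omega>. P \<omega> * (1 + sin (\<xi> \<bullet> Y \<omega>)) * sin (b * (j \<bullet> Y \<omega>))) =
      expectation (\<lambda>\<omega>. P \<omega> * sin (b * (j \<bullet> Y \<omega>)) +
        (P \<omega> * cos (\<xi> \<bullet> Y \<omega> - b * (j \<bullet> Y \<omega>)) + P \<omega> * (- cos (\<xi> \<bullet> Y \<omega> + b * (j \<bullet> Y \<omega>)))) / 2)"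
      by (intro Bochner_Integration.integral_cong refl) (simp add: cos_add cos_diff algebra_simps)
    also have "\<dots> = p * expectation (\<lambda>\<omega>. sin (b * (j \<bullet> Y \<omega>)))"
      by (subst split) (auto simp: s0 cp cm marg)
    finally show "expectation (\<lambda>\<omega>. P \<omega> * (1 + sin (\<xi> \<bullet> Y \<omega>)) * sin (b * (j \<bullet> Y \<omega>))) =
      p * expectation (\<lambda>\<omega>. sin (b * (j \<bullet> Y \<omega>)))" .
  qed auto
  have i0: "integrable M (\<lambda>\<omega>. P \<omega> * indicator (A j) (j \<bullet> Y \<omega>))"
    by (rule Pint) (auto simp: indicator_def)
  have ic: "integrable M (\<lambda>\<omega>. P \<omega> * (cos (\<xi> \<bullet> Y \<omega>) * indicator (A j) (j \<bullet> Y \<omega>)))"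
    by (rule Pint) (auto simp: indicator_def)
  have isn: "integrable M (\<lambda>\<omega>. P \<omega> * (sin (\<xi> \<bullet> Y \<omega>) * indicator (A j) (j \<bullet> Y \<omega>)))"
    by (rule Pint) (auto simp: indicator_def)
  \<comment> \<open>Removing the contribution \<open>w0\<close> of the added constant 1 leaves the
    pure cosine and sine moments.\<close>
  have "p * q + expectation (\<lambda>\<omega>. P \<omega> * (cos (\<xi> \<bullet> Y \<omega>) * indicator (A j) (j \<bullet> Y \<omega>))) = p * (1 + E) * q"
    unfolding w1[symmetric] w0[symmetric]
    by (subst Bochner_Integration.integral_add[OF i0 ic, symmetric]) (simp add: algebra_simps)
  moreover have "p * q + expectation (\<lambda>\<omega>. P \<omega> * (sin (\<xi> \<bullet> Y \<omega>) * indicator (A j) (j \<bullet> Y \<omega>))) = p * q"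
    using w2 Bochner_Integration.integral_add[OF i0 isn] unfolding w0 by (simp add: algebra_simps)
  ultimately show ?case
    using insert(1,2) unfolding E_def
    by (simp add: P_def[symmetric] p_def[symmetric] q_def[symmetric] algebra_simps)
qed

lemma coordinates_independent:
  assumes [measurable]: "\<And>i. A i \<in> sets borel"
  shows "prob {\<omega>\<in>space M. \<forall>i\<in>Basis. i \<bullet> Y \<omega> \<in> A i} = (\<Prod>i\<in>Basis. prob {\<omega>\<in>space M. i \<bullet> Y \<omega> \<in> A i})"
proof -
  have ind: "expectation (\<lambda>\<omega>. indicator A' (f \<omega>)) = prob {\<omega>\<in>space M. f \<omega> \<in> A'}"
    if [measurable]: "f \<in> borel_measurable M" "A' \<in> sets borel" for f :: "'a \<Rightarrow> real" and A'
  proof -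
    have "expectation (\<lambda>\<omega>. indicator A' (f \<omega>)) = expectation (indicator {\<omega>\<in>space M. f \<omega> \<in> A'})"
      by (intro Bochner_Integration.integral_cong) (auto simp: indicator_def)
    also have "\<dots> = prob {\<omega>\<in>space M. f \<omega> \<in> A'}" by simp
    finally show ?thesis .
  qed
  have "prob {\<omega>\<in>space M. \<forall>i\<in>Basis. i \<bullet> Y \<omega> \<in> A i} =
      expectation (indicator {\<omega>\<in>space M. \<forall>i\<in>Basis. i \<bullet> Y \<omega> \<in> A i})" by simp
  \<comment> \<open>The cosine factor is 1; it is inserted to match the induction result at
    frequency 0, where orthogonality is trivial.\<close>
  also have "\<dots> = expectation (\<lambda>\<omega>. (\<Prod>i\<in>Basis. indicator (A i) (i \<bullet> Y \<omega>)) * cos (0 \<bullet> Y \<omega>))"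
    by (intro Bochner_Integration.integral_cong) (auto simp: indicator_def)
  also have "\<dots> = (\<Prod>i\<in>Basis. expectation (\<lambda>\<omega>. indicator (A i) (i \<bullet> Y \<omega>)))"
    using coordinates_independent_aux[of Basis A 0] by simp
  also have "\<dots> = (\<Prod>i\<in>Basis. prob {\<omega>\<in>space M. i \<bullet> Y \<omega> \<in> A i})"
    by (intro prod.cong ind) auto
  finally show ?thesis .
qed

end

section \<open>Subordination\<close>

text \<open>Altering the sequence on a null set makes it converge everywhere to a measurable limit;
  completeness carries measurability over to \<open>f\<close>, which agrees with that limit almost
  everywhere.\<close>

lemma (in complete_measure) borel_measurable_AE_LIMSEQ:
  fixes u :: "nat \<Rightarrow> 'a \<Rightarrow> 'b::metric_space"
  assumes u: "\<And>n. u n \<in> borel_measurable M" and lim: "AE x in M. (\<lambda>n. u n x) \<longlonglongrightarrow> f x"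
  shows "f \<in> borel_measurable M"
proof -
  obtain N where N: "{x\<in>space M. \<not> (\<lambda>n. u n x) \<longlonglongrightarrow> f x} \<subseteq> N" "N \<in> sets M" "emeasure M N = 0"
    using lim by (rule AE_E)
  define c :: 'b where "c = undefined"
  define f' where "f' x = (if x \<in> N then c else f x)" for x
  have f': "f' \<in> borel_measurable M"
  proof (rule borel_measurable_LIMSEQ_metric)
    show "(\<lambda>x. if x \<in> N then c else u n x) \<in> borel_measurable M" for n
      using u N(2) by (intro measurable_If_set) auto
    show "(\<lambda>n. if x \<in> N then c else u n x) \<longlonglongrightarrow> f' x" if "x \<in> space M" for x
      using that N(1) by (auto simp: f'_def)
  qed
  have "AE x in M. x \<notin> N" using N by (intro AE_not_in) auto
  then have ae: "AE x in M. x \<in> f' -` A \<inter> space M \<longleftrightarrow> x \<in> f -` A \<inter> space M" for A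
    by eventually_elim (auto simp: f'_def)
  show ?thesis
    using in_sets_AE[OF ae measurable_sets[OF f']] by (intro measurableI) auto
qed

lemma (in prob_space) expectation_bounded_convergence:
  fixes f :: "'a \<Rightarrow> real"
  assumes "AE \<omega> in M. (\<lambda>n. u n \<omega>) \<longlonglongrightarrow> f \<omega>"
    and "f \<in> borel_measurable M" "\<And>n. u n \<in> borel_measurable M"
    and "\<And>n \<omega>. \<bar>u n \<omega>\<bar> \<le> C"
  shows "(\<lambda>n. expectation (u n)) \<longlonglongrightarrow> expectation f"
  using assms by (intro integral_dominated_convergence[where w="\<lambda>_. C"]) auto

text \<open>Rounds a time up to the grid of mesh \<open>1 / 2 ^ n\<close>. Only countably many
  values occur, and \<open>nat\<close> sends negative input to 0, so the process is always evaluated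
  at an admissible, rational time.\<close>

definition dyadic_ceiling :: "nat \<Rightarrow> real \<Rightarrow> real" where
  "dyadic_ceiling n s = real (nat \<lceil>2 ^ n * s\<rceil>) / 2 ^ n"

lemma dyadic_ceiling_nonneg: "0 \<le> dyadic_ceiling n s"
  by (simp add: dyadic_ceiling_def)

lemma dyadic_ceiling_tendsto:
  assumes "0 \<le> s"
  shows "(\<lambda>n. dyadic_ceiling n s) \<longlonglongrightarrow> s"
proof (rule tendsto_sandwich)
  have eq: "dyadic_ceiling n s = of_int \<lceil>2 ^ n * s\<rceil> / 2 ^ n" for n
  proof -
    have "0 \<le> 2 ^ n * s" using assms by simp
    then have "0 \<le> \<lceil>2 ^ n * s\<rceil>" by linarith
    then show ?thesis by (simp add: dyadic_ceiling_def)
  qed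
  show "\<forall>\<^sub>F n in sequentially. s \<le> dyadic_ceiling n s"
    unfolding eq using le_of_int_ceiling by (intro always_eventually allI) (simp add: field_simps)
  show "\<forall>\<^sub>F n in sequentially. dyadic_ceiling n s \<le> s + (1 / 2) ^ n"
  proof (intro always_eventually allI)
    fix n
    have "of_int \<lceil>2 ^ n * s\<rceil> \<le> 2 ^ n * s + (1::real)" by linarith
    then show "dyadic_ceiling n s \<le> s + (1 / 2) ^ n"
      unfolding eq by (simp add: field_simps power_one_over)
  qed
  show "(\<lambda>n. s + (1 / 2) ^ n) \<longlonglongrightarrow> s"
    using tendsto_add[OF tendsto_const LIMSEQ_power_zero[of "1 / 2 :: real"], of s] by simp
qed simp

text \<open>Gathers the almost sure path properties into one event, so that each pathwise argument
  discards a single null set.\<close>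

definition regular_path :: "(real \<Rightarrow> 'w \<Rightarrow> 'b::euclidean_space) \<Rightarrow> (real \<Rightarrow> 'w \<Rightarrow> real) \<Rightarrow> 'w \<Rightarrow> bool" where
  "regular_path B S \<omega> \<longleftrightarrow> continuous_on {0..} (\<lambda>t. B t \<omega>) \<and> B 0 \<omega> = 0 \<and> S 0 \<omega> = 0 \<and>
     (\<forall>s t. 0 \<le> s \<and> s \<le> t \<longrightarrow> S s \<omega> \<le> S t \<omega>) \<and>
     (\<forall>t\<ge>0. continuous (at_right t) (\<lambda>s. S s \<omega>))"

lemma regular_path_mono:
  "regular_path B S \<omega> \<Longrightarrow> 0 \<le> s \<Longrightarrow> s \<le> t \<Longrightarrow> S s \<omega> \<le> S t \<omega>"
  by (auto simp: regular_path_def)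

lemma regular_path_nonneg:
  assumes "regular_path B S \<omega>" "0 \<le> t"
  shows "0 \<le> S t \<omega>"
  using regular_path_mono[OF assms(1) order_refl assms(2)] assms(1) by (simp add: regular_path_def)

lemma regular_path_tendsto:
  assumes "regular_path B S \<omega>" "0 \<le> s" "(q \<longlongrightarrow> s) F" "\<And>n. 0 \<le> q n"
  shows "((\<lambda>n. B (q n) \<omega>) \<longlongrightarrow> B s \<omega>) F"
  using assms by (intro continuous_on_tendsto_compose[of "{0..}" "\<lambda>t. B t \<omega>"]) (auto simp: regular_path_def)

lemma regular_path_right_continuous:
  assumes "regular_path B S \<omega>" "0 \<le> t"
  shows "continuous (at_right t) (\<lambda>s. subordinate B S s \<omega>)"
proof -
  have S: "((\<lambda>s. S s \<omega>) \<longlongrightarrow> S t \<omega>) (at_right t)"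
    using assms by (auto simp: regular_path_def continuous_within)
  have "\<forall>\<^sub>F s in at_right t. S s \<omega> \<in> {0..}"
    using eventually_at_right_less[of t]
    by eventually_elim (use assms regular_path_nonneg in force)
  then show ?thesis
    using assms S regular_path_nonneg[OF assms] unfolding continuous_within subordinate_def
    by (intro continuous_on_tendsto_compose[of "{0..}" "\<lambda>t. B t \<omega>"]) (auto simp: regular_path_def)
qed

section \<open>Independence, measurability and the characteristic function of the subordinate
  process\<close>

locale subordinate_brownian_motion =
  fixes M :: "'w measure" and B :: "real \<Rightarrow> 'w \<Rightarrow> 'b::euclidean_space" and S :: "real \<Rightarrow> 'w \<Rightarrow> real"
    and \<Psi> :: "real \<Rightarrow> real"
  assumes pair: "brownian_subordinator_pair M B S \<Psi>"
begin

sublocale prob_space M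
  using pair by (auto simp: brownian_subordinator_pair_def brownian_motion_def levy_process_def)

sublocale complete_measure M
  using pair by (auto simp: brownian_subordinator_pair_def)

abbreviation X :: "real \<Rightarrow> 'w \<Rightarrow> 'b" where
  "X \<equiv> subordinate B S"

lemma levy_B: "levy_process M B" and levy_S: "levy_process M S"
  and bm: "brownian_motion M B" and sub: "subordinator M S \<Psi>"
  using pair by (auto simp: brownian_subordinator_pair_def brownian_motion_def subordinator_def)

lemma measurable_B [measurable]: "0 \<le> t \<Longrightarrow> B t \<in> borel_measurable M"
  using levy_B by (auto simp: levy_process_def)

lemma measurable_S [measurable]: "0 \<le> t \<Longrightarrow> S t \<in> borel_measurable M"
  using levy_S by (auto simp: levy_process_def)

lemma AE_regular_path: "AE \<omega> in M. regular_path B S \<omega>"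
proof -
  have "AE \<omega> in M. continuous_on {0..} (\<lambda>t. B t \<omega>)" using bm by (simp add: brownian_motion_def)
  moreover have "AE \<omega> in M. B 0 \<omega> = 0" using levy_B by (simp add: levy_process_def)
  moreover have "AE \<omega> in M. S 0 \<omega> = 0" using levy_S by (simp add: levy_process_def)
  moreover have "AE \<omega> in M. \<forall>s t. 0 \<le> s \<and> s \<le> t \<longrightarrow> S s \<omega> \<le> S t \<omega>"
    using sub by (simp add: subordinator_def)
  moreover have "AE \<omega> in M. (\<forall>t\<ge>0. continuous (at_right t) (\<lambda>s. S s \<omega>)) \<and>
      (\<forall>t>0. \<exists>l. ((\<lambda>s. S s \<omega>) \<longlongrightarrow> l) (at_left t))"
    using levy_S by (simp add: levy_process_def)
  ultimately show ?thesis unfolding regular_path_def by eventually_elim auto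
qed

lemma isotropic_gaussian_B:
  assumes "0 < s"
  shows "isotropic_gaussian M (B s) s"
proof -
  have [measurable]: "B s \<in> borel_measurable M" using assms by simp
  have "Complex (expectation (\<lambda>\<omega>. 1 * cos (\<xi> \<bullet> B s \<omega>))) (expectation (\<lambda>\<omega>. 1 * sin (\<xi> \<bullet> B s \<omega>))) =
      (CLINT \<omega>|M. 1 *\<^sub>R iexp (\<xi> \<bullet> B s \<omega>))" for \<xi>
    by (rule integral_iexp_eq[symmetric, where C=1]) auto
  also have "\<dots> \<xi> = of_real (exp (- s * (norm \<xi>)\<^sup>2))" for \<xi>
    using bm assms by (simp add: brownian_motion_def)
  finally have "expectation (\<lambda>\<omega>. cos (\<xi> \<bullet> B s \<omega>)) = exp (- s * (norm \<xi>)\<^sup>2) \<and>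
      expectation (\<lambda>\<omega>. sin (\<xi> \<bullet> B s \<omega>)) = 0" for \<xi>
    by (simp add: complex_eq_iff)
  then show ?thesis using assms by unfold_locales auto
qed

abbreviation paths :: "(real \<Rightarrow> 'b) measure" where
  "paths \<equiv> Pi\<^sub>M {0..} (\<lambda>_. borel)"

text \<open>The restriction makes the path an element of the extensional product space, the form in
  which independence of \<open>B\<close> and \<open>S\<close> is given.\<close>

abbreviation path_B :: "'w \<Rightarrow> real \<Rightarrow> 'b" where
  "path_B \<omega> \<equiv> \<lambda>t\<in>{0..}. B t \<omega>"

lemma measurable_path_B [measurable]: "path_B \<in> measurable M paths"
  by (rule measurable_restrict) auto

text \<open>\<open>S t\<close> is a coordinate of the path of \<open>S\<close>, so independence of
  the two path sigma-algebras gives the product formula on measurable rectangles, which determines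
  the joint law.\<close>

lemma distr_path_B_S:
  assumes "0 \<le> t"
  shows "distr M paths path_B \<Otimes>\<^sub>M distr M borel (S t) =
    distr M (paths \<Otimes>\<^sub>M borel) (\<lambda>\<omega>. (path_B \<omega>, S t \<omega>))"
proof (rule pair_measure_eqI)
  have [measurable]: "S t \<in> borel_measurable M" using assms by simp
  interpret P1: prob_space "distr M paths path_B" by (rule prob_space_distr) measurable
  interpret P2: prob_space "distr M borel (S t)" by (rule prob_space_distr) measurable
  show "sigma_finite_measure (distr M paths path_B)" "sigma_finite_measure (distr M borel (S t))" ..
  show "sets (distr M paths path_B \<Otimes>\<^sub>M distr M borel (S t)) =
      sets (distr M (paths \<Otimes>\<^sub>M borel) (\<lambda>\<omega>. (path_B \<omega>, S t \<omega>)))"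
    by (simp cong: sets_pair_measure_cong)
  fix A C assume "A \<in> sets (distr M paths path_B)" "C \<in> sets (distr M borel (S t))"
  then have [measurable]: "A \<in> sets paths" "C \<in> sets borel" by simp_all
  let ?S = "\<lambda>\<omega>. \<lambda>t\<in>{0..}. S t \<omega>" and ?N = "Pi\<^sub>M {0..} (\<lambda>_. borel) :: (real \<Rightarrow> real) measure"
  have "path_B -` A \<inter> space M \<in> sets (vimage_algebra (space M) path_B paths)"
    by (rule in_vimage_algebra) fact
  moreover have "S t -` C \<inter> space M \<in> sets (vimage_algebra (space M) ?S ?N)"
  proof -
    have "(\<lambda>p. p t) -` C \<inter> space ?N \<in> sets ?N"
      using assms by (intro measurable_sets[OF measurable_component_singleton]) auto
    from in_vimage_algebra[OF this, of ?S "space M"]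
    show ?thesis
      using assms by (elim back_subst[where P="\<lambda>A. A \<in> _"]) (auto simp: space_PiM)
  qed
  ultimately have "prob ((path_B -` A \<inter> space M) \<inter> (S t -` C \<inter> space M)) =
      prob (path_B -` A \<inter> space M) * prob (S t -` C \<inter> space M)"
    using pair by (intro indep_setD) (auto simp: brownian_subordinator_pair_def)
  moreover have "(\<lambda>\<omega>. (path_B \<omega>, S t \<omega>)) -` (A \<times> C) \<inter> space M =
      (path_B -` A \<inter> space M) \<inter> (S t -` C \<inter> space M)" by auto
  ultimately show "emeasure (distr M paths path_B) A * emeasure (distr M borel (S t)) C =
      emeasure (distr M (paths \<Otimes>\<^sub>M borel) (\<lambda>\<omega>. (path_B \<omega>, S t \<omega>))) (A \<times> C)"
    by (simp add: emeasure_distr emeasure_eq_measure ennreal_mult)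
qed

lemma measurable_compose_dyadic_ceiling:
  assumes "\<And>r. 0 \<le> r \<Longrightarrow> (\<lambda>x. f r x) \<in> borel_measurable N" "g \<in> borel_measurable N"
  shows "(\<lambda>x. f (dyadic_ceiling n (g x)) x) \<in> borel_measurable N"
proof -
  have [measurable]: "g \<in> borel_measurable N" by fact
  have "(\<lambda>x. nat \<lceil>2 ^ n * g x\<rceil>) \<in> measurable N (count_space UNIV)" by measurable
  then show ?thesis
    unfolding dyadic_ceiling_def
    by (rule measurable_compose_countable[rotated]) (rule assms, simp)
qed

lemma measurable_X [measurable]:
  assumes "0 \<le> t"
  shows "X t \<in> borel_measurable M"
proof (rule borel_measurable_AE_LIMSEQ)
  show "(\<lambda>\<omega>. B (dyadic_ceiling n (S t \<omega>)) \<omega>) \<in> borel_measurable M" for n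
    by (rule measurable_compose_dyadic_ceiling) (auto simp: assms)
  show "AE \<omega> in M. (\<lambda>n. B (dyadic_ceiling n (S t \<omega>)) \<omega>) \<longlonglongrightarrow> X t \<omega>"
    using AE_regular_path
  proof eventually_elim
    fix \<omega> assume \<omega>: "regular_path B S \<omega>"
    show "(\<lambda>n. B (dyadic_ceiling n (S t \<omega>)) \<omega>) \<longlonglongrightarrow> X t \<omega>"
      unfolding subordinate_def using regular_path_nonneg[OF \<omega> assms]
      by (intro regular_path_tendsto[OF \<omega>] dyadic_ceiling_tendsto dyadic_ceiling_nonneg)
  qed
qed

text \<open>Conditioning on the value of \<open>S t\<close> in integrated form: \<open>g s\<close>
  is the expectation with the random time frozen at \<open>s\<close>. The event \<open>A\<close>
  retains information about the whole Brownian path, which the maximum principle uses to keep the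
  path in the domain.\<close>

lemma expectation_subordinate:
  fixes f :: "'b \<Rightarrow> real"
  assumes t: "0 \<le> t" and f: "continuous_on UNIV f" "\<And>y. \<bar>f y\<bar> \<le> C"
    and A [measurable]: "A \<in> sets paths" and J [measurable]: "J \<in> sets borel"
  defines "g \<equiv> \<lambda>s. expectation (\<lambda>\<omega>. indicator A (path_B \<omega>) * f (B s \<omega>))"
  shows "expectation (\<lambda>\<omega>. indicator A (path_B \<omega>) * indicator J (S t \<omega>) * f (X t \<omega>)) =
      expectation (\<lambda>\<omega>. indicator J (S t \<omega>) * g (S t \<omega>))"
    and "(\<lambda>\<omega>. g (S t \<omega>)) \<in> borel_measurable M"
    and "\<And>s. \<bar>g s\<bar> \<le> C"
proof -
  note [measurable] = borel_measurable_continuous_onI[OF f(1)]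
  have [measurable]: "S t \<in> borel_measurable M" "X t \<in> borel_measurable M" using t by auto
  have "0 \<le> C" using f(2)[of 0] by simp
  show gC: "\<bar>g s\<bar> \<le> C" for s
  proof -
    have "\<bar>indicator A (path_B \<omega>) * f (B s \<omega>)\<bar> \<le> C" for \<omega>
      using f(2)[of "B s \<omega>"] \<open>0 \<le> C\<close> by (simp add: indicator_def)
    note bnd = this
    show ?thesis
    \<comment> \<open>For \<open>s < 0\<close> nothing is known about \<open>B s\<close>; if
      integrability fails, the integral is 0 by convention and the bound still holds.\<close>
    proof (cases "integrable M (\<lambda>\<omega>. indicator A (path_B \<omega>) * f (B s \<omega>))")
      case True
      have "\<bar>g s\<bar> \<le> expectation (\<lambda>\<omega>. \<bar>indicator A (path_B \<omega>) * f (B s \<omega>)\<bar>)"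
        unfolding g_def by (rule integral_abs_bound)
      also have "\<dots> \<le> expectation (\<lambda>\<omega>. C)"
        using True bnd by (intro integral_mono integrable_abs) auto
      finally show ?thesis by (simp add: prob_space)
    next
      case False
      then show ?thesis using \<open>0 \<le> C\<close> by (simp add: g_def not_integrable_integral_eq)
    qed
  qed
  have "(\<lambda>n. expectation (\<lambda>\<omega>. indicator A (path_B \<omega>) * f (B (dyadic_ceiling n s) \<omega>))) \<longlonglongrightarrow>
      expectation (\<lambda>\<omega>. indicator A (path_B \<omega>) * f (B s \<omega>))" if "0 \<le> s" for s
  proof (rule expectation_bounded_convergence[where C=C])
    show "AE \<omega> in M. (\<lambda>n. indicator A (path_B \<omega>) * f (B (dyadic_ceiling n s) \<omega>))
        \<longlonglongrightarrow> indicator A (path_B \<omega>) * f (B s \<omega>)"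
      using AE_regular_path
    proof eventually_elim
      fix \<omega> assume \<omega>: "regular_path B S \<omega>"
      have "(\<lambda>n. B (dyadic_ceiling n s) \<omega>) \<longlonglongrightarrow> B s \<omega>"
        using that by (intro regular_path_tendsto[OF \<omega>] dyadic_ceiling_tendsto dyadic_ceiling_nonneg)
      then have "(\<lambda>n. f (B (dyadic_ceiling n s) \<omega>)) \<longlonglongrightarrow> f (B s \<omega>)"
        using f(1) by (intro continuous_on_tendsto_compose[of UNIV f]) auto
      then show "(\<lambda>n. indicator A (path_B \<omega>) * f (B (dyadic_ceiling n s) \<omega>))
        \<longlonglongrightarrow> indicator A (path_B \<omega>) * f (B s \<omega>)" by (intro tendsto_intros)
    qed
    show "(\<lambda>\<omega>. indicator A (path_B \<omega>) * f (B s \<omega>)) \<in> borel_measurable M"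
      using measurable_B[OF that] by measurable
    show "(\<lambda>\<omega>. indicator A (path_B \<omega>) * f (B (dyadic_ceiling n s) \<omega>)) \<in> borel_measurable M" for n
      using measurable_B[OF dyadic_ceiling_nonneg] by measurable
  qed (use f(2) \<open>0 \<le> C\<close> in \<open>auto simp: indicator_def\<close>)
  then have glim: "(\<lambda>n. g (dyadic_ceiling n s)) \<longlonglongrightarrow> g s" if "0 \<le> s" for s
    using that by (simp add: g_def)
  \<comment> \<open>Fubini is applied first with \<open>S t\<close> rounded up; the limit in
    \<open>n\<close> is taken on both sides afterwards.\<close>
  have fin: "expectation (\<lambda>\<omega>. indicator A (path_B \<omega>) * indicator J (S t \<omega>) * f (B (dyadic_ceiling n (S t \<omega>)) \<omega>)) =
      expectation (\<lambda>\<omega>. indicator J (S t \<omega>) * g (dyadic_ceiling n (S t \<omega>)))"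
    and meas: "(\<lambda>\<omega>. g (dyadic_ceiling n (S t \<omega>))) \<in> borel_measurable M" for n
  proof -
    define P1 where "P1 = distr M paths path_B"
    define P2 where "P2 = distr M borel (S t)"
    interpret P1: prob_space P1 unfolding P1_def by (rule prob_space_distr) measurable
    interpret P2: prob_space P2 unfolding P2_def by (rule prob_space_distr) measurable
    interpret P: pair_prob_space P1 P2 ..
    have [measurable_cong]: "sets P1 = sets paths" "sets P2 = sets borel" by (simp_all add: P1_def P2_def)
    define F where "F p s = indicator A p * indicator J s * f (p (dyadic_ceiling n s))" for p s
    \<comment> \<open>Only countably many rounded times occur, so evaluating a path at the rounded
      time is jointly measurable in the path and the time.\<close>
    have ev: "(\<lambda>x. fst x (dyadic_ceiling n (snd x))) \<in> borel_measurable (paths \<Otimes>\<^sub>M borel)"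
    proof (rule measurable_compose_dyadic_ceiling)
      show "(\<lambda>x. fst x r) \<in> borel_measurable (paths \<Otimes>\<^sub>M borel)" if "0 \<le> r" for r
        using that by (intro measurable_compose[OF measurable_fst] measurable_component_singleton) simp
    qed simp
    have Fm0 [measurable]: "(\<lambda>x. F (fst x) (snd x)) \<in> borel_measurable (paths \<Otimes>\<^sub>M borel)"
      unfolding F_def using ev by measurable
    have FC: "\<bar>F p s\<bar> \<le> C" for p s
      using f(2)[of "p (dyadic_ceiling n s)"] \<open>0 \<le> C\<close> by (simp add: F_def indicator_def)
    have Fm [measurable]: "(\<lambda>(p, s). F p s) \<in> borel_measurable (P1 \<Otimes>\<^sub>M P2)"
      using Fm0 by (simp add: split_beta' cong: measurable_cong_sets)
    have Fi: "integrable (P1 \<Otimes>\<^sub>M P2) (\<lambda>(p, s). F p s)"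
      using FC by (intro P.integrable_const_bound[where B=C]) auto
    have gF: "(LINT p|P1. F p s) = indicator J s * g (dyadic_ceiling n s)" for s
    proof -
      have "(\<lambda>p. F p s) \<in> borel_measurable paths"
        using measurable_compose[OF measurable_Pair2'[of s borel paths] Fm0] by simp
      then have "(LINT p|P1. F p s) = expectation (\<lambda>\<omega>. F (path_B \<omega>) s)"
        unfolding P1_def by (intro integral_distr) auto
      also have "\<dots> = expectation (\<lambda>\<omega>. indicator J s * (indicator A (path_B \<omega>) * f (B (dyadic_ceiling n s) \<omega>)))"
        by (intro Bochner_Integration.integral_cong) (auto simp: F_def dyadic_ceiling_nonneg)
      also have "\<dots> = indicator J s * g (dyadic_ceiling n s)"
        by (simp add: g_def)
      finally show ?thesis .
    qed
    have gm: "(\<lambda>s. LINT p|P1. F p s) \<in> borel_measurable borel"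
    proof (rule P1.borel_measurable_lebesgue_integral)
      have "(\<lambda>(s, p). (p, s)) \<in> borel \<Otimes>\<^sub>M P1 \<rightarrow>\<^sub>M P1 \<Otimes>\<^sub>M P2"
        using measurable_pair_swap'[of borel P1]
        by (simp cong: measurable_cong_sets sets_pair_measure_cong)
      from measurable_compose[OF this Fm]
      show "(\<lambda>(s, p). F p s) \<in> borel_measurable (borel \<Otimes>\<^sub>M P1)"
        by (simp add: split_beta')
    qed
    have "expectation (\<lambda>\<omega>. indicator A (path_B \<omega>) * indicator J (S t \<omega>) * f (B (dyadic_ceiling n (S t \<omega>)) \<omega>)) =
      expectation (\<lambda>\<omega>. (\<lambda>x. F (fst x) (snd x)) (path_B \<omega>, S t \<omega>))"
      by (intro Bochner_Integration.integral_cong) (auto simp: F_def dyadic_ceiling_nonneg)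
    also have "\<dots> = (LINT x|(distr M (paths \<Otimes>\<^sub>M borel) (\<lambda>\<omega>. (path_B \<omega>, S t \<omega>))). F (fst x) (snd x))"
      by (intro integral_distr[symmetric]) auto
    also have "distr M (paths \<Otimes>\<^sub>M borel) (\<lambda>\<omega>. (path_B \<omega>, S t \<omega>)) = P1 \<Otimes>\<^sub>M P2"
      unfolding P1_def P2_def by (rule distr_path_B_S[OF t, symmetric])
    also have "(LINT x|(P1 \<Otimes>\<^sub>M P2). F (fst x) (snd x)) = (LINT s|P2. LINT p|P1. F p s)"
      using P.integral_snd[OF Fi] by (simp add: split_beta')
    also have "\<dots> = expectation (\<lambda>\<omega>. LINT p|P1. F p (S t \<omega>))"
      unfolding P2_def using gm by (intro integral_distr) auto
    finally show "expectation (\<lambda>\<omega>. indicator A (path_B \<omega>) * indicator J (S t \<omega>) * f (B (dyadic_ceiling n (S t \<omega>)) \<omega>)) =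
      expectation (\<lambda>\<omega>. indicator J (S t \<omega>) * g (dyadic_ceiling n (S t \<omega>)))"
      by (simp only: gF)
    show "(\<lambda>\<omega>. g (dyadic_ceiling n (S t \<omega>))) \<in> borel_measurable M"
      by (rule measurable_compose_dyadic_ceiling) auto
  qed
  have nonneg: "AE \<omega> in M. 0 \<le> S t \<omega>"
    using AE_regular_path by eventually_elim (rule regular_path_nonneg[OF _ t])
  have lim2: "AE \<omega> in M. (\<lambda>n. g (dyadic_ceiling n (S t \<omega>))) \<longlonglongrightarrow> g (S t \<omega>)"
    using nonneg by eventually_elim (rule glim)
  show gm: "(\<lambda>\<omega>. g (S t \<omega>)) \<in> borel_measurable M"
    using meas lim2 by (rule borel_measurable_AE_LIMSEQ)
  have "(\<lambda>n. expectation (\<lambda>\<omega>. indicator J (S t \<omega>) * g (dyadic_ceiling n (S t \<omega>)))) \<longlonglongrightarrow>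
      expectation (\<lambda>\<omega>. indicator J (S t \<omega>) * g (S t \<omega>))"
  proof (rule expectation_bounded_convergence[where C=C])
    show "AE \<omega> in M. (\<lambda>n. indicator J (S t \<omega>) * g (dyadic_ceiling n (S t \<omega>)))
        \<longlonglongrightarrow> indicator J (S t \<omega>) * g (S t \<omega>)"
      using lim2 by eventually_elim (intro tendsto_intros)
  qed (use gC \<open>0 \<le> C\<close> gm meas in \<open>auto simp: indicator_def\<close>)
  moreover have "(\<lambda>n. expectation (\<lambda>\<omega>. indicator A (path_B \<omega>) * indicator J (S t \<omega>) * f (B (dyadic_ceiling n (S t \<omega>)) \<omega>)))
      \<longlonglongrightarrow> expectation (\<lambda>\<omega>. indicator A (path_B \<omega>) * indicator J (S t \<omega>) * f (X t \<omega>))"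
  proof (rule expectation_bounded_convergence[where C=C])
    show "AE \<omega> in M. (\<lambda>n. indicator A (path_B \<omega>) * indicator J (S t \<omega>) * f (B (dyadic_ceiling n (S t \<omega>)) \<omega>))
        \<longlonglongrightarrow> indicator A (path_B \<omega>) * indicator J (S t \<omega>) * f (X t \<omega>)"
      using AE_regular_path
    proof eventually_elim
      fix \<omega> assume \<omega>: "regular_path B S \<omega>"
      have "(\<lambda>n. B (dyadic_ceiling n (S t \<omega>)) \<omega>) \<longlonglongrightarrow> X t \<omega>"
        unfolding subordinate_def using regular_path_nonneg[OF \<omega> t]
        by (intro regular_path_tendsto[OF \<omega>] dyadic_ceiling_tendsto dyadic_ceiling_nonneg)
      then have "(\<lambda>n. f (B (dyadic_ceiling n (S t \<omega>)) \<omega>)) \<longlonglongrightarrow> f (X t \<omega>)"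
        using f(1) by (intro continuous_on_tendsto_compose[of UNIV f]) auto
      then show "(\<lambda>n. indicator A (path_B \<omega>) * indicator J (S t \<omega>) * f (B (dyadic_ceiling n (S t \<omega>)) \<omega>))
        \<longlonglongrightarrow> indicator A (path_B \<omega>) * indicator J (S t \<omega>) * f (X t \<omega>)" by (intro tendsto_intros)
    qed
    have [measurable]: "(\<lambda>\<omega>. B (dyadic_ceiling n (S t \<omega>)) \<omega>) \<in> borel_measurable M" for n
      by (rule measurable_compose_dyadic_ceiling) auto
    show "(\<lambda>\<omega>. indicator A (path_B \<omega>) * indicator J (S t \<omega>) * f (B (dyadic_ceiling n (S t \<omega>)) \<omega>))
        \<in> borel_measurable M" for n by measurable
  qed (use f(2) \<open>0 \<le> C\<close> in \<open>auto simp: indicator_def\<close>)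
  ultimately show "expectation (\<lambda>\<omega>. indicator A (path_B \<omega>) * indicator J (S t \<omega>) * f (X t \<omega>)) =
      expectation (\<lambda>\<omega>. indicator J (S t \<omega>) * g (S t \<omega>))"
    unfolding fin by (rule LIMSEQ_unique[rotated])
qed

lemma expectation_cos_B:
  assumes "0 \<le> s"
  shows "expectation (\<lambda>\<omega>. cos (\<xi> \<bullet> B s \<omega>)) = exp (- s * (norm \<xi>)\<^sup>2)"
    and "expectation (\<lambda>\<omega>. sin (\<xi> \<bullet> B s \<omega>)) = 0"
proof -
  have "expectation (\<lambda>\<omega>. cos (\<xi> \<bullet> B s \<omega>)) = exp (- s * (norm \<xi>)\<^sup>2) \<and>
    expectation (\<lambda>\<omega>. sin (\<xi> \<bullet> B s \<omega>)) = 0"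
  \<comment> \<open>Time 0 is degenerate and lies outside the Gaussian locale, which requires
    positive \<open>s\<close>.\<close>
  proof (cases "s = 0")
    case True
    have "AE \<omega> in M. B 0 \<omega> = 0" using levy_B by (simp add: levy_process_def)
    then have c: "AE \<omega> in M. cos (\<xi> \<bullet> B 0 \<omega>) = 1" and s: "AE \<omega> in M. sin (\<xi> \<bullet> B 0 \<omega>) = 0"
      by (eventually_elim, simp)+
    have [measurable]: "B 0 \<in> borel_measurable M" by simp
    have "expectation (\<lambda>\<omega>. cos (\<xi> \<bullet> B 0 \<omega>)) = expectation (\<lambda>\<omega>. 1)"
      using c by (intro integral_cong_AE) auto
    moreover have "expectation (\<lambda>\<omega>. sin (\<xi> \<bullet> B 0 \<omega>)) = 0"
      using s by (rule integral_eq_zero_AE)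
    ultimately show ?thesis using True by (simp add: prob_space)
  next
    case False
    then interpret isotropic_gaussian M "B s" s using assms isotropic_gaussian_B by simp
    show ?thesis using expectation_cos expectation_sin by simp
  qed
  then show "expectation (\<lambda>\<omega>. cos (\<xi> \<bullet> B s \<omega>)) = exp (- s * (norm \<xi>)\<^sup>2)"
    and "expectation (\<lambda>\<omega>. sin (\<xi> \<bullet> B s \<omega>)) = 0" by auto
qed

text \<open>Freezing the subordinator leaves the Laplace transform of \<open>S t\<close> at
  \<open>(norm \<xi>)\<^sup>2\<close>; this argument must be positive, hence
  \<open>\<xi> \<noteq> 0\<close>.\<close>

lemma expectation_cos_X:
  assumes "0 \<le> t" "\<xi> \<noteq> 0"
  shows "expectation (\<lambda>\<omega>. cos (\<xi> \<bullet> X t \<omega>)) = exp (- t * \<Psi> ((norm \<xi>)\<^sup>2))"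
proof -
  have "expectation (\<lambda>\<omega>. cos (\<xi> \<bullet> X t \<omega>)) = expectation (\<lambda>\<omega>. expectation (\<lambda>\<omega>'. cos (\<xi> \<bullet> B (S t \<omega>) \<omega>')))"
    using expectation_subordinate(1)[of t "\<lambda>y. cos (\<xi> \<bullet> y)" 1 "space paths" UNIV] assms(1)
      measurable_space[OF measurable_path_B]
    by (simp add: continuous_intros cong: Bochner_Integration.integral_cong)
  also have "\<dots> = expectation (\<lambda>\<omega>. exp (- (norm \<xi>)\<^sup>2 * S t \<omega>))"
  proof (rule integral_cong_AE)
    have "AE \<omega> in M. 0 \<le> S t \<omega>"
      using AE_regular_path by eventually_elim (rule regular_path_nonneg[OF _ assms(1)])
    then show "AE \<omega> in M. expectation (\<lambda>\<omega>'. cos (\<xi> \<bullet> B (S t \<omega>) \<omega>')) = exp (- (norm \<xi>)\<^sup>2 * S t \<omega>)"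
      by eventually_elim (simp add: expectation_cos_B(1) mult.commute)
    show "(\<lambda>\<omega>. expectation (\<lambda>\<omega>'. cos (\<xi> \<bullet> B (S t \<omega>) \<omega>'))) \<in> borel_measurable M"
      using expectation_subordinate(2)[of t "\<lambda>y. cos (\<xi> \<bullet> y)" 1 "space paths" UNIV] assms(1)
      measurable_space[OF measurable_path_B]
      by (simp add: continuous_intros cong: Bochner_Integration.integral_cong)
  qed (use assms measurable_S in simp)
  also have "\<dots> = exp (- t * \<Psi> ((norm \<xi>)\<^sup>2))"
    using sub assms by (auto simp: subordinator_def)
  finally show ?thesis .
qed

lemma expectation_sin_X:
  assumes "0 \<le> t"
  shows "expectation (\<lambda>\<omega>. sin (\<xi> \<bullet> X t \<omega>)) = 0"
proof -
  have "expectation (\<lambda>\<omega>. sin (\<xi> \<bullet> X t \<omega>)) = expectation (\<lambda>\<omega>. expectation (\<lambda>\<omega>'. sin (\<xi> \<bullet> B (S t \<omega>) \<omega>')))"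
    using expectation_subordinate(1)[of t "\<lambda>y. sin (\<xi> \<bullet> y)" 1 "space paths" UNIV] assms(1)
      measurable_space[OF measurable_path_B]
    by (simp add: continuous_intros cong: Bochner_Integration.integral_cong)
  also have "\<dots> = 0"
  proof (rule integral_eq_zero_AE)
    have "AE \<omega> in M. 0 \<le> S t \<omega>"
      using AE_regular_path by eventually_elim (rule regular_path_nonneg[OF _ assms(1)])
    then show "AE \<omega> in M. expectation (\<lambda>\<omega>'. sin (\<xi> \<bullet> B (S t \<omega>) \<omega>')) = 0"
      by eventually_elim (simp add: expectation_cos_B(2))
  qed
  finally show ?thesis .
qed

end

section \<open>Non-positivity of sub-solutions\<close>

lemma cos_ge_quadratic: "1 - x\<^sup>2 / 2 \<le> cos (x::real)"
proof -
  have "\<bar>sin (x / 2)\<bar> \<le> \<bar>x / 2\<bar>" by (rule abs_sin_x_le_abs_x)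
  then have "(sin (x / 2))\<^sup>2 \<le> (x / 2)\<^sup>2" by (simp only: abs_le_square_iff)
  then show ?thesis using cos_double_sin[of "x / 2"] by (simp add: power_divide)
qed

lemma AE_lborel_translate:
  assumes "N \<in> null_sets lborel"
  shows "AE x in lborel. x + c \<notin> (N :: 'b::euclidean_space set)"
proof -
  have N: "N \<in> sets borel" using assms by auto
  have "AE x in distr lborel borel ((+) c). x \<notin> N"
    unfolding lborel_distr_plus by (rule AE_not_in[OF assms])
  then show ?thesis
    using N by (subst (asm) AE_distr_iff) (auto simp: add.commute)
qed

text \<open>The set where the bound fails is open and Lebesgue null, hence empty.\<close>

lemma continuous_le_of_AE_le:
  fixes f :: "'b::euclidean_space \<Rightarrow> real"
  assumes "continuous_on UNIV f" "open D" "AE x in lborel. x \<in> D \<longrightarrow> f x \<le> c"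
  shows "\<forall>x\<in>D. f x \<le> c"
proof -
  define U where "U = {x. c < f x} \<inter> D"
  have "open U"
    unfolding U_def using assms(1,2) by (intro open_Int open_Collect_less continuous_on_const)
  have "AE x in lborel. x \<notin> U" using assms(3) by eventually_elim (auto simp: U_def)
  then have "U \<in> null_sets lborel"
    using \<open>open U\<close> by (simp add: AE_iff_null_sets)
  then have "negligible U"
    by (simp add: negligible_iff_null_sets null_sets_completionI)
  then have "U = {}" using open_not_negligible \<open>open U\<close> by blast
  then show ?thesis by (force simp: U_def)
qed

text \<open>\<open>S\<close> is monotone and \<open>B\<close> continuous, so the composition is
  Borel; \<open>max 0\<close> avoids negative times, which are unconstrained.\<close>

lemma regular_path_measurable:
  assumes "regular_path B S \<omega>"
  shows "(\<lambda>s. subordinate B S (max 0 s) \<omega>) \<in> borel_measurable borel"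
proof -
  have "continuous_on UNIV (\<lambda>u. B (max 0 u) \<omega>)"
    using assms
    by (intro continuous_on_compose2[of "{0..}" "\<lambda>t. B t \<omega>" UNIV "max 0"])
       (auto simp: regular_path_def intro!: continuous_intros)
  then have 1: "(\<lambda>u. B (max 0 u) \<omega>) \<in> borel_measurable borel"
    by (rule borel_measurable_continuous_onI)
  have "mono (\<lambda>s. S (max 0 s) \<omega>)"
    by (intro monoI regular_path_mono[OF assms]) auto
  then have 2: "(\<lambda>s. S (max 0 s) \<omega>) \<in> borel_measurable borel"
    by (rule borel_measurable_mono)
  have "subordinate B S (max 0 s) \<omega> = B (max 0 (S (max 0 s) \<omega>)) \<omega>" for s
    using regular_path_nonneg[OF assms, of "max 0 s"] by (simp add: subordinate_def)
  then show ?thesis using measurable_compose[OF 2 1] by simp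
qed

text \<open>A path that has left \<open>D\<close> by time \<open>t\<close> contributes at most 0, as
  \<open>\<phi> \<le> 0\<close> outside. Otherwise \<open>T = t\<close> and the path was in
  \<open>D\<close> at all intermediate times, so the exponential is at most
  \<open>exp (\<gamma> * t)\<close>.\<close>

lemma feynman_kac_functional_le:
  fixes \<phi> :: "'b::euclidean_space \<Rightarrow> real"
  assumes \<omega>: "regular_path B S \<omega>" and D: "open D" and t: "0 < t"
    and V: "V \<in> borel_measurable borel"
    and ae: "AE s in lborel. 0 \<le> s \<longrightarrow>
      \<bar>V (x + subordinate B S s \<omega>)\<bar> \<le> C \<and>
      (x + subordinate B S s \<omega> \<in> D \<longrightarrow> - \<gamma> \<le> V (x + subordinate B S s \<omega>))"
    and \<phi>: "\<And>y. y \<in> D \<Longrightarrow> \<phi> y \<le> K" "\<And>y. y \<notin> D \<Longrightarrow> \<phi> y \<le> 0" and K: "0 \<le> K"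
  defines "T \<equiv> stopped_time (subordinate B S) D x t \<omega>"
  shows "exp (- (LINT s:{0..T}|lborel. V (x + subordinate B S s \<omega>))) * \<phi> (x + subordinate B S T \<omega>) \<le>
    K * exp (\<gamma> * t) * indicator D (x + subordinate B S t \<omega>)"
proof -
  let ?X = "\<lambda>s. x + subordinate B S s \<omega>"
  have T: "0 \<le> T" "T \<le> t" unfolding T_def by (rule stopped_time_bounds[OF t])+
  have rc: "continuous (at_right s) (\<lambda>s. subordinate B S s \<omega>)" if "0 \<le> s" for s
    using regular_path_right_continuous[OF \<omega> that] .
  show ?thesis
  proof (cases "?X T \<in> D")
    case False
    then have "exp (- (LINT s:{0..T}|lborel. V (?X s))) * \<phi> (?X T) \<le> 0"
      using \<phi>(2) by (simp add: mult_le_0_iff)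
    also have "0 \<le> K * exp (\<gamma> * t) * indicator D (?X t)"
      using K by simp
    finally show ?thesis .
  next
    case True
    have "T = t"
    proof (rule ccontr)
      assume "T \<noteq> t"
      with T(2) have "T < t" by simp
      then have "?X T \<notin> D"
        using outside_at_stopped_time[OF D t, of "subordinate B S" x \<omega>] rc unfolding T_def by auto
      with True show False by simp
    qed
    have const_int: "integrable lborel (\<lambda>s. indicator {0..T} s *\<^sub>R c)" for c :: real
      by (intro integrable_scaleR_left integrable_real_indicator) (auto simp: emeasure_lborel_Icc_eq)
    have bnd: "AE s in lborel. \<bar>indicator {0..T} s *\<^sub>R V (?X s)\<bar> \<le> indicator {0..T} s *\<^sub>R C"
      using ae by eventually_elim (auto simp: indicator_def)
    have "(\<lambda>s. indicator {0..T} s *\<^sub>R V (?X s)) =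
        (\<lambda>s. indicator {0..T} s *\<^sub>R V (x + subordinate B S (max 0 s) \<omega>))"
      by (simp add: fun_eq_iff indicator_def max_def)
    moreover have "(\<lambda>s. indicator {0..T} s *\<^sub>R V (x + subordinate B S (max 0 s) \<omega>)) \<in> borel_measurable borel"
      using regular_path_measurable[OF \<omega>] V by measurable
    ultimately have "(\<lambda>s. indicator {0..T} s *\<^sub>R V (?X s)) \<in> borel_measurable borel" by (simp only:)
    then have int: "integrable lborel (\<lambda>s. indicator {0..T} s *\<^sub>R V (?X s))"
      using bnd
      by (intro Bochner_Integration.integrable_bound[OF const_int[of C]]) (auto elim!: eventually_mono)
    have "- \<gamma> * T = (LINT s|lborel. indicator {0..T} s *\<^sub>R (- \<gamma>))"
      using T(1) by simp
    also have "\<dots> \<le> (LINT s|lborel. indicator {0..T} s *\<^sub>R V (?X s))"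
    proof (rule integral_mono_AE[OF const_int int])
      show "AE s in lborel. indicator {0..T} s *\<^sub>R (- \<gamma>) \<le> indicator {0..T} s *\<^sub>R V (?X s)"
        \<comment> \<open>Membership in \<open>D\<close> is known only strictly between 0 and
          \<open>T\<close>; the two endpoints form a null set of times.\<close>
        using ae AE_lborel_singleton[of 0] AE_lborel_singleton[of T]
      proof eventually_elim
        fix s :: real
        assume *: "0 \<le> s \<longrightarrow> \<bar>V (?X s)\<bar> \<le> C \<and> (?X s \<in> D \<longrightarrow> - \<gamma> \<le> V (?X s))" "s \<noteq> 0" "s \<noteq> T"
        show "indicator {0..T} s *\<^sub>R (- \<gamma>) \<le> indicator {0..T} s *\<^sub>R V (?X s)"
        proof (cases "s \<in> {0..T}")
          case True
          then have "?X s \<in> D"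
            using * t unfolding T_def by (intro in_domain_before_stopped_time[of _ _ _ _ t]) auto
          with * True show ?thesis by simp
        qed simp
      qed
    qed
    finally have "- (LINT s:{0..T}|lborel. V (?X s)) \<le> \<gamma> * t"
      by (simp add: set_lebesgue_integral_def \<open>T = t\<close>)
    \<comment> \<open>Since \<open>\<phi>\<close> may be negative, it is replaced by
      \<open>K\<close> before the exponential is enlarged.\<close>
    then have "exp (- (LINT s:{0..T}|lborel. V (?X s))) \<le> exp (\<gamma> * t)" by simp
    moreover have "\<phi> (?X T) \<le> K" using \<phi>(1) True by simp
    ultimately have "exp (- (LINT s:{0..T}|lborel. V (?X s))) * \<phi> (?X T) \<le> exp (\<gamma> * t) * K"
      using K by (meson exp_ge_zero mult_left_mono mult_right_mono order_trans)
    then show ?thesis using True by (simp add: \<open>T = t\<close> mult.commute)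
  qed
qed

section \<open>Leaving a half-space, and averaging the pathwise bounds\<close>

context subordinate_brownian_motion
begin

text \<open>A small mean of \<open>cos (Z / r)\<close> prevents \<open>Z\<close> from concentrating
  near 0, and symmetry sends half of the escaping mass past the bounding hyperplane.\<close>

lemma prob_X_lt_le:
  assumes a: "norm a = 1" and r: "0 < r" and t: "0 \<le> t" and small: "exp (- t * \<Psi> (1 / r\<^sup>2)) \<le> 1 / 4"
  shows "prob {\<omega>\<in>space M. a \<bullet> X t \<omega> < 11 / 10 * r} \<le> 95 / 100"
proof -
  define Z where "Z \<omega> = a \<bullet> X t \<omega>" for \<omega>
  define \<rho> where "\<rho> = 11 / 10 * r"
  have "a \<noteq> 0" using a by auto
  have [measurable]: "X t \<in> borel_measurable M" using t by simp
  have [measurable]: "Z \<in> borel_measurable M" unfolding Z_def by measurable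
  have sin0: "expectation (\<lambda>\<omega>. sin (b * Z \<omega>)) = 0" for b
    using expectation_sin_X[OF t, of "b *\<^sub>R a"] by (simp add: Z_def)
  have "char (distr M borel (\<lambda>\<omega>. - Z \<omega>)) b = char (distr M borel Z) b" for b
  proof -
    have ch: "char (distr M borel Y) b =
        Complex (expectation (\<lambda>\<omega>. cos (b * Y \<omega>))) (expectation (\<lambda>\<omega>. sin (b * Y \<omega>)))"
      if [measurable]: "Y \<in> borel_measurable M" for Y
    proof -
      have "char (distr M borel Y) b = (CLINT \<omega>|M. 1 *\<^sub>R iexp (b * Y \<omega>))"
        unfolding char_def by (subst integral_distr) (auto simp: mult.commute)
      also have "\<dots> = Complex (LINT \<omega>|M. 1 * cos (b * Y \<omega>)) (LINT \<omega>|M. 1 * sin (b * Y \<omega>))"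
        by (rule integral_iexp_eq[where C=1]) auto
      finally show ?thesis by simp
    qed
    show ?thesis by (simp add: ch sin0)
  qed
  \<comment> \<open>Vanishing sine moments make the characteristic function real, so the law of
    \<open>Z\<close> is symmetric.\<close>
  then have sym: "distr M borel (\<lambda>\<omega>. - Z \<omega>) = distr M borel Z"
    by (intro Levy_uniqueness real_distribution_distr ext) auto
  have "measure (distr M borel (\<lambda>\<omega>. - Z \<omega>)) {\<rho>..} = prob {\<omega>\<in>space M. Z \<omega> \<le> - \<rho>}"
    by (subst measure_distr) (auto intro!: arg_cong[where f=prob])
  moreover have "measure (distr M borel Z) {\<rho>..} = prob {\<omega>\<in>space M. \<rho> \<le> Z \<omega>}"
    by (subst measure_distr) (auto intro!: arg_cong[where f=prob])
  ultimately have sym': "prob {\<omega>\<in>space M. Z \<omega> \<le> - \<rho>} = prob {\<omega>\<in>space M. \<rho> \<le> Z \<omega>}"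
    unfolding sym by simp
  define E where "E = {\<omega>\<in>space M. \<rho> \<le> \<bar>Z \<omega>\<bar>}"
  have [measurable]: "E \<in> sets M" unfolding E_def by measurable
  have iE: "integrable M (\<lambda>\<omega>. 1395 / 1000 * indicator E \<omega> :: real)"
    by (rule integrable_bounded[where C=2]) (auto simp: indicator_def)
  \<comment> \<open>On the complement of \<open>E\<close> the cosine is at least
    \<open>1 - (11 / 10)\<^sup>2 / 2 = 395 / 1000\<close>; on \<open>E\<close> only the bound
    \<open>- 1 = 395 / 1000 - 1395 / 1000\<close> is used.\<close>
  have "395 / 1000 - 1395 / 1000 * prob E = expectation (\<lambda>\<omega>. 395 / 1000 - 1395 / 1000 * indicator E \<omega>)"
    using iE by (subst Bochner_Integration.integral_diff) (auto simp: prob_space)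
  also have "\<dots> \<le> expectation (\<lambda>\<omega>. cos (Z \<omega> / r))"
  proof (rule integral_mono)
    fix \<omega> assume "\<omega> \<in> space M"
    show "395 / 1000 - 1395 / 1000 * indicator E \<omega> \<le> cos (Z \<omega> / r)"
    proof (cases "\<omega> \<in> E")
      case True
      then show ?thesis using cos_ge_minus_one[of "Z \<omega> / r"] by simp
    next
      case False
      then have "\<bar>Z \<omega>\<bar> \<le> \<bar>11 / 10 * r\<bar>" using \<open>\<omega> \<in> space M\<close> r by (simp add: E_def \<rho>_def)
      then have "(Z \<omega>)\<^sup>2 \<le> (11 / 10 * r)\<^sup>2" by (simp only: abs_le_square_iff)
      then have "(Z \<omega> / r)\<^sup>2 \<le> (11 / 10)\<^sup>2"
        using r by (simp add: power_divide power_mult_distrib pos_divide_le_eq)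
      then show ?thesis
        using cos_ge_quadratic[of "Z \<omega> / r"] False by (simp add: power2_eq_square)
    qed
  next
    show "integrable M (\<lambda>\<omega>. 395 / 1000 - 1395 / 1000 * indicator E \<omega> :: real)"
      by (intro Bochner_Integration.integrable_diff iE) simp
    show "integrable M (\<lambda>\<omega>. cos (Z \<omega> / r))"
      by (rule integrable_bounded[where C=1]) auto
  qed
  also have "\<dots> = exp (- t * \<Psi> (1 / r\<^sup>2))"
    using expectation_cos_X[OF t, of "a /\<^sub>R r"] a r \<open>a \<noteq> 0\<close>
    by (auto simp: Z_def divide_inverse_commute power_inverse)
  also note small
  \<comment> \<open>The mean is at most \<open>1 / 4\<close>, and \<open>145 / 1395\<close> exceeds
    \<open>1 / 10\<close>.\<close>
  finally have "1 / 10 \<le> prob E" by simp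
  also have "E = {\<omega>\<in>space M. \<rho> \<le> Z \<omega>} \<union> {\<omega>\<in>space M. Z \<omega> \<le> - \<rho>}"
    by (auto simp: E_def abs_if)
  also have "prob \<dots> \<le> prob {\<omega>\<in>space M. \<rho> \<le> Z \<omega>} + prob {\<omega>\<in>space M. Z \<omega> \<le> - \<rho>}"
    by (rule measure_Un_le) measurable
  finally have "5 / 100 \<le> prob {\<omega>\<in>space M. \<rho> \<le> Z \<omega>}" unfolding sym' by simp
  moreover have "prob {\<omega>\<in>space M. \<not> \<rho> \<le> Z \<omega>} = 1 - prob {\<omega>\<in>space M. \<rho> \<le> Z \<omega>}"
    by (rule prob_neg) measurable
  ultimately show ?thesis by (simp add: Z_def \<rho>_def not_le)
qed

text \<open>If \<open>S\<close> has no drift and finite jump measure, \<open>X\<close> rests at its starting point for a positive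
  time, so the exceptional set of starting points cannot be avoided.\<close>

lemma AE_path_avoids_null_set:
  assumes N: "N \<in> null_sets lborel"
  shows "AE x in lborel. AE \<omega> in M. AE s in lborel. 0 \<le> s \<longrightarrow> x + X s \<omega> \<notin> N"
proof -
  obtain N0 where N0: "{\<omega>\<in>space M. \<not> regular_path B S \<omega>} \<subseteq> N0" "N0 \<in> sets M" "emeasure M N0 = 0"
    using AE_regular_path by (rule AE_E)
  have N0_ae: "AE \<omega> in M. \<omega> \<notin> N0" using N0 by (intro AE_not_in) auto
  \<comment> \<open>A version of the process, altered on the null set \<open>N0\<close> and at
    negative times, that is right continuous everywhere on \<open>{0..}\<close> and hence jointly
    measurable.\<close>
  define h where "h \<omega> s = (if \<omega> \<in> N0 then 0 else X (max 0 s) \<omega>)" for \<omega> s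
  \<comment> \<open>The floor plus one gives a grid time strictly above \<open>max 0 s\<close>, so
    the approximation runs through \<open>at_right\<close>, where right continuity applies.\<close>
  define d where "d n s = real (Suc (nat \<lfloor>2 ^ n * max 0 s\<rfloor>)) / 2 ^ n" for n :: nat and s :: real
  have d_gt: "max 0 s < d n s" for n s
  proof -
    have "2 ^ n * max 0 s < real (Suc (nat \<lfloor>2 ^ n * max 0 s\<rfloor>))" by linarith
    then have "2 ^ n * max 0 s / 2 ^ n < d n s"
      unfolding d_def by (rule divide_strict_right_mono) simp
    then show ?thesis by simp
  qed
  have d_le: "d n s \<le> max 0 s + (1 / 2) ^ n" for n s
  proof -
    have "0 \<le> 2 ^ n * max 0 s" by simp
    then have "real (Suc (nat \<lfloor>2 ^ n * max 0 s\<rfloor>)) \<le> 2 ^ n * max 0 s + 1" by linarith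
    then show ?thesis by (simp add: d_def field_simps power_one_over)
  qed
  have d_lim: "filterlim (\<lambda>n. d n s) (at_right (max 0 s)) sequentially" for s
  proof (rule tendsto_imp_filterlim_at_right)
    show "(\<lambda>n. d n s) \<longlonglongrightarrow> max 0 s"
    proof (rule tendsto_sandwich)
      show "\<forall>\<^sub>F n in sequentially. max 0 s \<le> d n s" by (intro always_eventually allI less_imp_le d_gt)
      show "\<forall>\<^sub>F n in sequentially. d n s \<le> max 0 s + (1 / 2) ^ n" by (intro always_eventually allI d_le)
      show "(\<lambda>n. max 0 s + (1 / 2) ^ n) \<longlonglongrightarrow> max 0 s"
        using tendsto_add[OF tendsto_const LIMSEQ_power_zero[of "1 / 2 :: real"], of "max 0 s"] by simp
    qed simp
  qed (intro always_eventually allI d_gt)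
  have hm: "(\<lambda>z. h (fst z) (snd z)) \<in> borel_measurable (M \<Otimes>\<^sub>M lborel)"
  proof (rule borel_measurable_LIMSEQ_metric)
    show "(\<lambda>z. if fst z \<in> N0 then 0 else X (d n (snd z)) (fst z)) \<in> borel_measurable (M \<Otimes>\<^sub>M lborel)" for n
    proof -
      have "(\<lambda>z. nat \<lfloor>2 ^ n * max (0::real) (snd z)\<rfloor>) \<in> measurable (M \<Otimes>\<^sub>M lborel) (count_space UNIV)"
        by measurable
      then have "(\<lambda>z. X (d n (snd z)) (fst z)) \<in> borel_measurable (M \<Otimes>\<^sub>M lborel)"
        unfolding d_def
        by (rule measurable_compose_countable[rotated]) (rule measurable_compose[OF measurable_fst], simp)
      then show ?thesis using N0(2) by measurable
    qed
    fix z :: "'w \<times> real" assume z: "z \<in> space (M \<Otimes>\<^sub>M lborel)"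
    show "(\<lambda>n. if fst z \<in> N0 then 0 else X (d n (snd z)) (fst z)) \<longlonglongrightarrow> h (fst z) (snd z)"
    proof (cases "fst z \<in> N0")
      case False
      then have "regular_path B S (fst z)" using N0(1) z by (auto simp: space_pair_measure)
      then have "((\<lambda>s. X s (fst z)) \<longlongrightarrow> X (max 0 (snd z)) (fst z)) (at_right (max 0 (snd z)))"
        using regular_path_right_continuous[of B S "fst z" "max 0 (snd z)"] by (simp add: continuous_within)
      from filterlim_compose[OF this d_lim] False show ?thesis by (simp add: h_def)
    qed (simp add: h_def)
  qed
  interpret P1: pair_sigma_finite M "lborel :: real measure" ..
  interpret P2: pair_sigma_finite "lborel :: 'b measure" "M \<Otimes>\<^sub>M (lborel :: real measure)" ..
  have Nb: "N \<in> sets borel" using N by auto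
  have "(\<lambda>w. fst w + h (fst (snd w)) (snd (snd w))) \<in> borel_measurable (lborel \<Otimes>\<^sub>M (M \<Otimes>\<^sub>M lborel))"
    using measurable_compose[OF measurable_snd hm] by measurable
  then have "{w \<in> space (lborel \<Otimes>\<^sub>M (M \<Otimes>\<^sub>M lborel)). fst w + h (fst (snd w)) (snd (snd w)) \<notin> N}
      \<in> sets (lborel \<Otimes>\<^sub>M (M \<Otimes>\<^sub>M lborel))"
    using Nb by measurable
  \<comment> \<open>For fixed path and time the bad starting points form a translate of
    \<open>N\<close>, a null set; Fubini exchanges the order of the quantifiers.\<close>
  from P2.AE_commute[OF this]
  have "AE x in lborel. AE z in M \<Otimes>\<^sub>M lborel. x + h (fst z) (snd z) \<notin> N"
    using AE_lborel_translate[OF N] by simp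
  then show ?thesis
  proof eventually_elim
    fix x assume "AE z in M \<Otimes>\<^sub>M lborel. x + h (fst z) (snd z) \<notin> N"
    then have "AE \<omega> in M. AE s in lborel. x + h \<omega> s \<notin> N"
      using P1.AE_pair[of "\<lambda>z. x + h (fst z) (snd z) \<notin> N"] by simp
    with N0_ae show "AE \<omega> in M. AE s in lborel. 0 \<le> s \<longrightarrow> x + X s \<omega> \<notin> N"
    proof eventually_elim
      fix \<omega> assume "\<omega> \<notin> N0" "AE s in lborel. x + h \<omega> s \<notin> N"
      from this(2) show "AE s in lborel. 0 \<le> s \<longrightarrow> x + X s \<omega> \<notin> N"
        by eventually_elim (use \<open>\<omega> \<notin> N0\<close> in \<open>auto simp: h_def max_def split: if_splits\<close>)
    qed
  qed
qed

text \<open>The bounds on \<open>V\<close> hold only almost everywhere, so the pathwise estimate is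
  averaged for almost every starting point and extended to all of \<open>D\<close> by continuity of
  \<open>\<phi>\<close>.\<close>

lemma subsolution_le:
  assumes sol: "weak_subsolution M X D V \<phi>" and D: "open D" and t: "0 < t"
    and V: "V \<in> borel_measurable borel" "AE x in lborel. \<bar>V x\<bar> \<le> C"
      "AE x in lborel. x \<in> D \<longrightarrow> - \<gamma> \<le> V x"
    and \<phi>: "\<And>y. y \<in> D \<Longrightarrow> \<phi> y \<le> K" "\<And>y. y \<notin> D \<Longrightarrow> \<phi> y \<le> 0" and K: "0 \<le> K"
    and q: "\<And>x. x \<in> D \<Longrightarrow> prob {\<omega>\<in>space M. x + X t \<omega> \<in> D} \<le> q"
  shows "\<forall>x\<in>D. \<phi> x \<le> K * exp (\<gamma> * t) * q"
proof (rule continuous_le_of_AE_le[OF _ D])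
  show "continuous_on UNIV \<phi>" using sol by (simp add: weak_subsolution_def)
  have [measurable]: "D \<in> sets borel" "V \<in> borel_measurable borel" "X t \<in> borel_measurable M"
    using D V t by auto
  define N where "N = {y. \<not> (\<bar>V y\<bar> \<le> C \<and> (y \<in> D \<longrightarrow> - \<gamma> \<le> V y))}"
  have "AE y in lborel. y \<notin> N" using V(2,3) by eventually_elim (auto simp: N_def)
  moreover have "N \<in> sets lborel" unfolding N_def by measurable
  ultimately have "N \<in> null_sets lborel" by (simp add: Measure_Space.AE_iff_null_sets)
  from AE_path_avoids_null_set[OF this]
  show "AE x in lborel. x \<in> D \<longrightarrow> \<phi> x \<le> K * exp (\<gamma> * t) * q"
  proof eventually_elim
    fix x assume ae: "AE \<omega> in M. AE s in lborel. 0 \<le> s \<longrightarrow> x + X s \<omega> \<notin> N"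
    show "x \<in> D \<longrightarrow> \<phi> x \<le> K * exp (\<gamma> * t) * q"
    proof
      assume "x \<in> D"
      define T where "T = stopped_time X D x t"
      define Z where "Z \<omega> = exp (- (LINT s:{0..T \<omega>}|lborel. V (x + X s \<omega>))) * \<phi> (x + X (T \<omega>) \<omega>)" for \<omega>
      define E where "E = {\<omega>\<in>space M. x + X t \<omega> \<in> D}"
      have [measurable]: "E \<in> sets M" unfolding E_def by measurable
      have Z: "integrable M Z" "\<phi> x \<le> expectation Z"
        using sol t \<open>x \<in> D\<close> unfolding weak_subsolution_def Let_def T_def Z_def by auto
      have "AE \<omega> in M. Z \<omega> \<le> K * exp (\<gamma> * t) * indicator D (x + X t \<omega>)"
        using ae AE_regular_path
      proof eventually_elim
        fix \<omega> assume "AE s in lborel. 0 \<le> s \<longrightarrow> x + X s \<omega> \<notin> N" and \<omega>: "regular_path B S \<omega>"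
        from this(1) have "AE s in lborel. 0 \<le> s \<longrightarrow>
           \<bar>V (x + X s \<omega>)\<bar> \<le> C \<and> (x + X s \<omega> \<in> D \<longrightarrow> - \<gamma> \<le> V (x + X s \<omega>))"
          by eventually_elim (auto simp: N_def)
        from feynman_kac_functional_le[OF \<omega> D t V(1) this \<phi> K]
        show "Z \<omega> \<le> K * exp (\<gamma> * t) * indicator D (x + X t \<omega>)" unfolding Z_def T_def .
      qed
      moreover have "integrable M (\<lambda>\<omega>. indicator D (x + X t \<omega>) :: real)"
        by (rule integrable_bounded[where C=1]) (auto simp: indicator_def)
      ultimately have "expectation Z \<le> expectation (\<lambda>\<omega>. K * exp (\<gamma> * t) * indicator D (x + X t \<omega>))"
        using Z(1) by (intro integral_mono_AE) auto
      also have "\<dots> = K * exp (\<gamma> * t) * expectation (\<lambda>\<omega>. indicator D (x + X t \<omega>))" by simp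
      also have "expectation (\<lambda>\<omega>. indicator D (x + X t \<omega>) :: real) = expectation (indicator E)"
        by (intro Bochner_Integration.integral_cong) (auto simp: E_def indicator_def)
      also have "\<dots> = prob E" by simp
      also have "K * exp (\<gamma> * t) * prob E \<le> K * exp (\<gamma> * t) * q"
        using q[OF \<open>x \<in> D\<close>] K by (intro mult_left_mono) (auto simp: E_def)
      finally show "\<phi> x \<le> K * exp (\<gamma> * t) * q" using Z(2) by simp
    qed
  qed
qed

text \<open>With \<open>K\<close> the supremum of the positive part, one time step yields
  \<open>K \<le> K * (exp (\<gamma> * t) * q)\<close> with a factor below 1, which forces
  \<open>K = 0\<close>.\<close>

theorem subsolution_nonpos:
  assumes sol: "weak_subsolution M X D V \<phi>"
    and D: "open D" "convex D" "D \<noteq> {}" "finite_inradius D"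
    and V: "V \<in> borel_measurable borel" "AE x in lborel. \<bar>V x\<bar> \<le> C"
      "AE x in lborel. x \<in> D \<longrightarrow> - \<gamma> \<le> V x"
    and \<phi>: "bdd_above (\<phi> ` D)" "\<And>y. y \<notin> D \<Longrightarrow> \<phi> y \<le> 0"
    and \<Psi>: "0 \<le> \<Psi> (1 / (inrad D)\<^sup>2)"
    and \<gamma>: "\<gamma> < 1 / 50 * \<Psi> (1 / (inrad D)\<^sup>2)"
  shows "\<forall>x\<in>D. \<phi> x \<le> 0"
proof -
  define r where "r = inrad D"
  define \<psi> where "\<psi> = \<Psi> (1 / r\<^sup>2)"
  have r: "0 < r" using inrad_pos[OF D(1,3,4)] by (simp add: r_def)
  have \<psi>: "0 \<le> \<psi>" "\<gamma> < 1 / 50 * \<psi>" using \<Psi> \<gamma> by (auto simp: \<psi>_def r_def)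
  obtain t q where t: "0 < t" and q: "0 \<le> q" "exp (\<gamma> * t) * q < 1"
    "\<And>x. x \<in> D \<Longrightarrow> prob {\<omega>\<in>space M. x + X t \<omega> \<in> D} \<le> q"
  proof (cases "\<psi> = 0")
    case True
    \<comment> \<open>Here \<open>\<gamma> < 0\<close>, so the potential alone contracts and the
      trivial probability bound \<open>q = 1\<close> suffices.\<close>
    then show thesis using \<psi> by (intro that[of 1 1]) auto
  next
    case False
    with \<psi> have "0 < \<psi>" by simp
    \<comment> \<open>This time makes the characteristic function at frequency \<open>1 / r\<close>
      equal to \<open>exp (- 2)\<close>, below the threshold \<open>1 / 4\<close>.\<close>
    define t where "t = 2 / \<psi>"
    have t: "0 < t" using \<open>0 < \<psi>\<close> by (simp add: t_def)
    have e1: "2 \<le> exp (1::real)" using exp_ge_add_one_self[of 1] by simp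
    have "4 \<le> exp (1::real) * exp 1" using mult_mono[OF e1 e1] by simp
    then have "exp (- 2 :: real) \<le> 1 / 4"
      by (simp add: exp_minus exp_add[symmetric] field_simps)
    moreover have "- t * \<psi> = - 2" using False by (simp add: t_def)
    ultimately have small: "exp (- t * \<Psi> (1 / r\<^sup>2)) \<le> 1 / 4" by (simp add: \<psi>_def)
    show thesis
    proof (rule that[OF t, of "95 / 100"])
      \<comment> \<open>The constant \<open>1 / 50\<close> enters here: exponential growth is at
        most \<open>25 / 24\<close>, and \<open>25 / 24 * (95 / 100) < 1\<close>.\<close>
      have "\<gamma> * t \<le> 1 / 25"
        using \<psi>(2) t \<open>0 < \<psi>\<close> by (simp add: t_def field_simps)
      then have "exp (\<gamma> * t) \<le> exp (1 / 25)" by simp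
      moreover have "24 / 25 \<le> exp (- (1 / 25) :: real)"
        using exp_ge_add_one_self[of "- (1 / 25) :: real"] by simp
      then have "exp (1 / 25 :: real) \<le> 25 / 24" by (simp add: exp_minus field_simps)
      ultimately have "exp (\<gamma> * t) \<le> 25 / 24" by (rule order_trans)
      then show "exp (\<gamma> * t) * (95 / 100) < 1" by simp
      fix x assume "x \<in> D"
      \<comment> \<open>The factor \<open>11 / 10\<close> supplies the strict gap above the
        inradius.\<close>
      obtain a where a: "norm a = 1" "\<And>y. y \<in> D \<Longrightarrow> a \<bullet> (y - x) < 11 / 10 * r"
        using convex_in_near_halfspace[OF D(1,3,2,4), of "11 / 10 * r" x] r unfolding r_def by auto
      have [measurable]: "X t \<in> borel_measurable M" using t by simp
      have "prob {\<omega>\<in>space M. x + X t \<omega> \<in> D} \<le> prob {\<omega>\<in>space M. a \<bullet> X t \<omega> < 11 / 10 * r}"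
      proof (rule finite_measure_mono)
        show "{\<omega>\<in>space M. x + X t \<omega> \<in> D} \<subseteq> {\<omega>\<in>space M. a \<bullet> X t \<omega> < 11 / 10 * r}"
          using a(2)[of "x + _"] by auto
      qed measurable
      also have "\<dots> \<le> 95 / 100"
        using a(1) r t small by (intro prob_X_lt_le) auto
      finally show "prob {\<omega>\<in>space M. x + X t \<omega> \<in> D} \<le> 95 / 100" .
    qed simp
  qed
  define K where "K = max 0 (SUP x\<in>D. \<phi> x)"
  have \<phi>K: "\<phi> y \<le> K" if "y \<in> D" for y
    using cSUP_upper[OF that \<phi>(1)] by (simp add: K_def)
  have "\<forall>x\<in>D. \<phi> x \<le> K * exp (\<gamma> * t) * q"
    using \<phi>K \<phi>(2) q(3) by (intro subsolution_le[OF sol D(1) t V]) (auto simp: K_def)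
  then have "(SUP x\<in>D. \<phi> x) \<le> K * (exp (\<gamma> * t) * q)"
    using D(3) by (intro cSUP_least) (auto simp: mult.assoc)
  then have "K \<le> K * (exp (\<gamma> * t) * q)"
    using q(1) unfolding K_def by (auto simp: max_def)
  moreover have "0 \<le> K" by (simp add: K_def)
  ultimately have "K = 0"
    using q(2) mult_strict_left_mono[of "exp (\<gamma> * t) * q" 1 K] by (cases "K = 0") auto
  then show ?thesis using \<phi>K by simp
qed

end

section \<open>The strong maximum principle\<close>

lemma std_normal_measure_pos:
  assumes "A \<in> sets borel" "\<not> negligible A"
  shows "0 < measure std_normal_distribution A"
proof -
  interpret real_distribution std_normal_distribution by (rule real_dist_normal_dist)
  have "A \<notin> null_sets std_normal_distribution"
  proof
    assume "A \<in> null_sets std_normal_distribution"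
    then have "AE x in lborel. x \<in> A \<longrightarrow> ennreal (std_normal_density x) = 0"
      by (subst (asm) null_sets_density_iff) auto
    then have "AE x in lborel. x \<notin> A"
      by eventually_elim (auto simp: std_normal_density_def)
    then have "A \<in> null_sets lborel" using assms(1) by (simp add: AE_iff_null_sets)
    then show False
      using assms(2) by (simp add: negligible_iff_null_sets null_sets_completionI)
  qed
  then have "emeasure std_normal_distribution A \<noteq> 0" using assms(1) by auto
  then show ?thesis by (simp add: emeasure_eq_measure zero_less_measure_iff)
qed

lemma std_normal_tail_small:
  assumes "0 < \<epsilon>"
  obtains L where "0 \<le> L" "measure std_normal_distribution {x. L < \<bar>x\<bar>} < \<epsilon>"
proof -
  interpret real_distribution std_normal_distribution by (rule real_dist_normal_dist)
  define A where "A n = {x::real. real n < \<bar>x\<bar>}" for n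
  have ex: "\<exists>n. x \<notin> A n" for x
    using reals_Archimedean2[of "\<bar>x\<bar>"] by (auto simp: A_def not_less intro: less_imp_le)
  have "(\<lambda>n. measure std_normal_distribution (A n)) \<longlonglongrightarrow> measure std_normal_distribution (\<Inter>n. A n)"
    by (rule finite_Lim_measure_decseq) (auto simp: A_def decseq_def)
  also have "(\<Inter>n. A n) = {}"
    using ex by blast
  finally have "(\<lambda>n. measure std_normal_distribution (A n)) \<longlonglongrightarrow> 0" by simp
  then have "\<forall>\<^sub>F n in sequentially. measure std_normal_distribution (A n) < \<epsilon>"
    using assms by (rule order_tendstoD(2))
  then obtain n where "measure std_normal_distribution (A n) < \<epsilon>"
    by (auto simp: eventually_sequentially)
  then show thesis by (intro that[of "real n"]) (auto simp: A_def)
qed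

context isotropic_gaussian
begin

lemma prob_ball_pos:
  assumes "0 < \<rho>"
  shows "0 < prob {\<omega>\<in>space M. Y \<omega> \<in> ball c \<rho>}"
proof -
  \<comment> \<open>The open cube of half-width \<open>\<eta>\<close> around \<open>c\<close> lies
    in the ball, because the norm is at most the sum of the absolute coordinates. Independence makes
    the probability of the cube a product of positive factors.\<close>
  define \<eta> where "\<eta> = \<rho> / real DIM('b)"
  have \<eta>: "0 < \<eta>" "real DIM('b) * \<eta> = \<rho>" using assms by (simp_all add: \<eta>_def)
  have [measurable]: "ball c \<rho> \<in> sets borel" by simp
  define A where "A i = {i \<bullet> c - \<eta><..<i \<bullet> c + \<eta>}" for i
  have "0 < prob {\<omega>\<in>space M. i \<bullet> Y \<omega> \<in> A i}" if "i \<in> Basis" for i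
  proof -
    have pos: "0 < sqrt (2 * s)" using s_pos by simp
    have lt: "(i \<bullet> c - \<eta>) / sqrt (2 * s) < (i \<bullet> c + \<eta>) / sqrt (2 * s)"
      using \<eta>(1) pos by (intro divide_strict_right_mono) auto
    have "0 < measure std_normal_distribution
        {(i \<bullet> c - \<eta>) / sqrt (2 * s)<..<(i \<bullet> c + \<eta>) / sqrt (2 * s)}"
      using lt by (intro std_normal_measure_pos open_not_negligible) auto
    also have "\<dots> = prob {\<omega>\<in>space M. (i \<bullet> Y \<omega>) / sqrt (2 * s) \<in>
        {(i \<bullet> c - \<eta>) / sqrt (2 * s)<..<(i \<bullet> c + \<eta>) / sqrt (2 * s)}}"
      using that by (intro prob_marginal[symmetric]) auto
    also have "\<dots> = prob {\<omega>\<in>space M. i \<bullet> Y \<omega> \<in> A i}"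
      using pos by (simp add: A_def divide_less_cancel)
    finally show ?thesis .
  qed
  then have "0 < (\<Prod>i\<in>Basis. prob {\<omega>\<in>space M. i \<bullet> Y \<omega> \<in> A i})" by (intro prod_pos) auto
  also have "\<dots> = prob {\<omega>\<in>space M. \<forall>i\<in>Basis. i \<bullet> Y \<omega> \<in> A i}"
    by (rule coordinates_independent[symmetric]) (simp add: A_def)
  also have "\<dots> \<le> prob {\<omega>\<in>space M. Y \<omega> \<in> ball c \<rho>}"
  proof (rule finite_measure_mono)
    show "{\<omega>\<in>space M. \<forall>i\<in>Basis. i \<bullet> Y \<omega> \<in> A i} \<subseteq> {\<omega>\<in>space M. Y \<omega> \<in> ball c \<rho>}"
    proof safe
      fix \<omega> assume *: "\<forall>i\<in>Basis. i \<bullet> Y \<omega> \<in> A i"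
      have "norm (Y \<omega> - c) \<le> (\<Sum>i\<in>Basis. \<bar>(Y \<omega> - c) \<bullet> i\<bar>)" by (rule norm_le_l1)
      also have "\<dots> < (\<Sum>i\<in>(Basis :: 'b set). \<eta>)"
      proof (rule sum_strict_mono)
        fix i :: 'b assume "i \<in> Basis"
        with * have "i \<bullet> Y \<omega> \<in> A i" by blast
        then show "\<bar>(Y \<omega> - c) \<bullet> i\<bar> < \<eta>"
          by (auto simp: A_def inner_diff_right inner_commute abs_less_iff)
      qed auto
      also have "\<dots> = \<rho>" using \<eta>(2) by simp
      finally show "Y \<omega> \<in> ball c \<rho>" by (simp add: dist_norm norm_minus_commute)
    qed
  qed measurable
  finally show ?thesis .
qed

text \<open>The ball \<open>ball (\<rho> e) \<rho>\<close> touches the origin, so that for small \<open>s\<close> it looks like a half-space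
  at the scale of \<open>Y\<close>.\<close>

lemma prob_touching_ball_ge:
  fixes e :: 'b
  defines "\<kappa> \<equiv> measure std_normal_distribution {1..}"
  assumes e: "norm e = 1" and L: "0 \<le> L"
    and tail: "real DIM('b) * measure std_normal_distribution {x. L < \<bar>x\<bar>} \<le> \<kappa> / 2"
    and small: "sqrt (2 * s) * (real DIM('b) * L\<^sup>2) < 2 * \<rho>"
  shows "\<kappa> / 2 \<le> prob {\<omega>\<in>space M. Y \<omega> \<in> ball (\<rho> *\<^sub>R e) \<rho>}"
proof -
  define \<sigma> where "\<sigma> = sqrt (2 * s)"
  have \<sigma>: "0 < \<sigma>" using s_pos by (simp add: \<sigma>_def)
  have "0 \<le> \<sigma> * (real DIM('b) * L\<^sup>2)" using \<sigma> by simp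
  with small have \<rho>: "0 < \<rho>" unfolding \<sigma>_def by linarith
  define H where "H = {\<omega>\<in>space M. (e \<bullet> Y \<omega>) / \<sigma> \<in> {1..}}"
  define F where "F i = {\<omega>\<in>space M. (i \<bullet> Y \<omega>) / \<sigma> \<in> {x. L < \<bar>x\<bar>}}" for i :: 'b
  define G where "G = {\<omega>\<in>space M. Y \<omega> \<in> ball (\<rho> *\<^sub>R e) \<rho>}"
  have [measurable]: "ball (\<rho> *\<^sub>R e) \<rho> \<in> sets borel" by simp
  have meas: "H \<in> sets M" "F i \<in> sets M" "G \<in> sets M" for i
    unfolding H_def F_def G_def by measurable
  then have meas_UN: "(\<Union>i\<in>Basis. F i) \<in> sets M" by (intro sets.finite_UN) auto
  \<comment> \<open>If the component along \<open>e\<close> is at least \<open>\<sigma>\<close> and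
    every coordinate is at most \<open>L * \<sigma>\<close> in size, then the squared norm of
    \<open>Y\<close> is below \<open>2 * \<rho> * (e \<bullet> Y \<omega>)\<close>, which is
    membership in the touching ball.\<close>
  have "H \<subseteq> G \<union> (\<Union>i\<in>Basis. F i)"
  proof
    fix \<omega> assume "\<omega> \<in> H"
    then have \<omega>: "\<omega> \<in> space M" and "1 \<le> (e \<bullet> Y \<omega>) / \<sigma>" by (auto simp: H_def)
    then have ge: "\<sigma> \<le> e \<bullet> Y \<omega>" using \<sigma> by (simp add: pos_le_divide_eq)
    show "\<omega> \<in> G \<union> (\<Union>i\<in>Basis. F i)"
    proof (cases "\<exists>i\<in>Basis. \<omega> \<in> F i")
      case False
      have "(Y \<omega> \<bullet> i)\<^sup>2 \<le> (L * \<sigma>)\<^sup>2" if "i \<in> Basis" for i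
      proof -
        have "\<bar>(i \<bullet> Y \<omega>) / \<sigma>\<bar> \<le> L" using False that \<omega> by (auto simp: F_def not_less)
        then have "\<bar>i \<bullet> Y \<omega>\<bar> \<le> L * \<sigma>" using \<sigma> by (simp add: abs_divide pos_divide_le_eq)
        then show ?thesis
          using L \<sigma> by (intro abs_le_square_iff[THEN iffD1]) (simp add: inner_commute)
      qed
      then have "(\<Sum>i\<in>Basis. (Y \<omega> \<bullet> i)\<^sup>2) \<le> (\<Sum>i\<in>(Basis :: 'b set). (L * \<sigma>)\<^sup>2)" by (rule sum_mono)
      then have "Y \<omega> \<bullet> Y \<omega> \<le> real DIM('b) * (L * \<sigma>)\<^sup>2"
        unfolding euclidean_inner[of "Y \<omega>" "Y \<omega>"] by (simp add: power2_eq_square)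
      also have "\<dots> = \<sigma> * (\<sigma> * (real DIM('b) * L\<^sup>2))" by (simp add: power2_eq_square)
      also have "\<dots> < \<sigma> * (2 * \<rho>)" using small \<sigma> by (simp add: \<sigma>_def)
      also have "\<dots> \<le> (e \<bullet> Y \<omega>) * (2 * \<rho>)" using ge \<rho> by simp
      finally have lt: "Y \<omega> \<bullet> Y \<omega> < 2 * \<rho> * (e \<bullet> Y \<omega>)" by (simp add: mult.commute)
      have "e \<bullet> e = 1" using e by (simp add: norm_eq_1)
      then have "(norm (\<rho> *\<^sub>R e - Y \<omega>))\<^sup>2 = \<rho>\<^sup>2 - 2 * \<rho> * (e \<bullet> Y \<omega>) + Y \<omega> \<bullet> Y \<omega>"
        by (simp only: power2_norm_eq_inner)
          (simp add: inner_diff_left inner_diff_right inner_commute[of "Y \<omega>" e] power2_eq_square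
            algebra_simps)
      with lt have "(norm (\<rho> *\<^sub>R e - Y \<omega>))\<^sup>2 < \<rho>\<^sup>2" by simp
      then have "norm (\<rho> *\<^sub>R e - Y \<omega>) < \<rho>" using \<rho> by (simp add: power_less_imp_less_base)
      then show ?thesis using \<omega> by (simp add: G_def dist_norm)
    qed auto
  qed
  then have "prob H \<le> prob (G \<union> (\<Union>i\<in>Basis. F i))" using meas meas_UN by (intro finite_measure_mono) auto
  also have "\<dots> \<le> prob G + prob (\<Union>i\<in>Basis. F i)" using meas meas_UN by (intro measure_Un_le) auto
  also have "prob (\<Union>i\<in>Basis. F i) \<le> (\<Sum>i\<in>Basis. prob (F i))" using meas by (intro measure_UNION_le) auto
  also have "\<dots> = (\<Sum>i\<in>(Basis :: 'b set). measure std_normal_distribution {x. L < \<bar>x\<bar>})"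
    unfolding F_def \<sigma>_def by (intro sum.cong refl prob_marginal) auto
  also have "\<dots> \<le> \<kappa> / 2" using tail by simp
  finally have "prob H \<le> prob G + \<kappa> / 2" by simp
  moreover have "prob H = \<kappa>" unfolding H_def \<sigma>_def \<kappa>_def using e by (intro prob_marginal) auto
  ultimately show ?thesis unfolding G_def by simp
qed

end

section \<open>From a zero of the sub-solution to values avoided by the subordinator\<close>

context subordinate_brownian_motion
begin

text \<open>At a zero, a non-positive random variable has non-negative mean, so it vanishes almost
  surely; its exponential factor is positive. A path that stays in \<open>D\<close> is stopped
  exactly at \<open>t\<close>.\<close>

lemma zero_propagates:
  assumes sol: "weak_subsolution M X D V \<phi>" and D: "open D" and t: "0 < t"
    and x: "x \<in> D" "\<phi> x = 0" and \<phi>: "\<And>y. \<phi> y \<le> 0"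
  shows "AE \<omega> in M. (\<forall>s\<in>{0..t}. x + X s \<omega> \<in> D) \<longrightarrow> \<phi> (x + X t \<omega>) = 0"
proof -
  define T where "T = stopped_time X D x t"
  define Z where "Z \<omega> = exp (- (LINT s:{0..T \<omega>}|lborel. V (x + X s \<omega>))) * \<phi> (x + X (T \<omega>) \<omega>)" for \<omega>
  have Z: "integrable M Z" "0 \<le> expectation Z"
    using sol t x unfolding weak_subsolution_def Let_def T_def Z_def by force+
  have Z_le: "Z \<omega> \<le> 0" for \<omega> using \<phi> by (simp add: Z_def mult_le_0_iff)
  then have "expectation Z \<le> 0" using integral_mono[OF Z(1), of "\<lambda>_. 0"] by simp
  with Z(2) have "expectation (\<lambda>\<omega>. - Z \<omega>) = 0" by simp
  then have "AE \<omega> in M. - Z \<omega> = 0"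
    using Z(1) Z_le by (subst (asm) integral_nonneg_eq_0_iff_AE) auto
  then show ?thesis
    using AE_regular_path
  proof eventually_elim
    fix \<omega> assume "- Z \<omega> = 0" and \<omega>: "regular_path B S \<omega>"
    then have 0: "\<phi> (x + X (T \<omega>) \<omega>) = 0" by (simp add: Z_def)
    show "(\<forall>s\<in>{0..t}. x + X s \<omega> \<in> D) \<longrightarrow> \<phi> (x + X t \<omega>) = 0"
    proof
      assume in_D: "\<forall>s\<in>{0..t}. x + X s \<omega> \<in> D"
      have T: "0 \<le> T \<omega>" "T \<omega> \<le> t" unfolding T_def by (rule stopped_time_bounds[OF t])+
      have "\<not> T \<omega> < t"
      proof
        assume "T \<omega> < t"
        then have "x + X (T \<omega>) \<omega> \<notin> D"
          using outside_at_stopped_time[OF D t, of X x \<omega>] regular_path_right_continuous[OF \<omega>]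
          unfolding T_def by blast
        with in_D T show False by auto
      qed
      with T 0 show "\<phi> (x + X t \<omega>) = 0" by simp
    qed
  qed
qed

text \<open>Probabilities summing to more than 1 force a non-null overlap; no independence of
  \<open>E\<close> and \<open>F\<close> is available when both depend on the same Brownian
  path.\<close>

lemma expectation_indicator_mult_pos:
  fixes h :: "'w \<Rightarrow> real"
  assumes "E \<in> sets M" "F \<in> sets M" "1 < prob E + prob F"
    and h: "h \<in> borel_measurable M" "\<And>\<omega>. 0 \<le> h \<omega>" "\<And>\<omega>. h \<omega> \<le> C" "\<And>\<omega>. \<omega> \<in> F \<Longrightarrow> 0 < h \<omega>"
  shows "0 < expectation (\<lambda>\<omega>. indicator E \<omega> * h \<omega>)"
proof -
  have [measurable]: "E \<in> sets M" "F \<in> sets M" "h \<in> borel_measurable M" by fact+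
  have "0 \<le> C" by (rule order_trans[OF h(2) h(3)])
  have int: "integrable M (\<lambda>\<omega>. indicator E \<omega> * h \<omega>)"
    using h(2,3) \<open>0 \<le> C\<close> by (intro integrable_bounded[where C=C]) (auto simp: indicator_def)
  have "expectation (\<lambda>\<omega>. indicator E \<omega> * h \<omega>) \<noteq> 0"
  proof
    assume "expectation (\<lambda>\<omega>. indicator E \<omega> * h \<omega>) = 0"
    then have "AE \<omega> in M. indicator E \<omega> * h \<omega> = 0"
      using int h(2) by (subst (asm) integral_nonneg_eq_0_iff_AE) auto
    then have "AE \<omega> in M. \<omega> \<notin> E \<inter> F" by eventually_elim (use h(4) in force)
    then have "prob (E \<inter> F) = 0" by (subst prob_eq_0) auto
    moreover have "prob (E \<union> F) = prob E + prob F - prob (E \<inter> F)"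
      by (rule measure_Un3) (auto simp: fmeasurable_eq_sets)
    ultimately show False using assms(3) prob_le_1[of "E \<union> F"] by simp
  qed
  moreover have "0 \<le> expectation (\<lambda>\<omega>. indicator E \<omega> * h \<omega>)"
    using h(2) by (intro integral_nonneg_AE) auto
  ultimately show ?thesis by simp
qed

text \<open>Were \<open>S t\<close> in \<open>J\<close> with positive probability, \<open>X\<close>
  would enter the ball where \<open>\<phi> < 0\<close> without leaving \<open>D\<close>, against
  propagation of the zero. \<open>A\<close> is the event on the Brownian path that helps confine it
  to \<open>D\<close>.\<close>

lemma AE_S_notin:
  assumes sol: "weak_subsolution M X D V \<phi>" and D: "open D" and t: "0 < t"
    and x: "x \<in> D" "\<phi> x = 0" and \<phi>: "\<And>y. \<phi> y \<le> 0"
    and A: "A \<in> sets paths" and J: "J \<in> sets borel"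
    and ball: "\<And>y. y \<in> ball c \<rho> \<Longrightarrow> \<phi> y < 0" and \<rho>: "0 < \<rho>"
    and in_D: "AE \<omega> in M. path_B \<omega> \<in> A \<longrightarrow> S t \<omega> \<in> J \<longrightarrow> x + X t \<omega> \<in> ball c \<rho> \<longrightarrow> (\<forall>s\<in>{0..t}. x + X s \<omega> \<in> D)"
    and large: "\<And>s. s \<in> J \<Longrightarrow> 0 < s \<and>
      1 < prob {\<omega>\<in>space M. path_B \<omega> \<in> A} + prob {\<omega>\<in>space M. x + B s \<omega> \<in> ball c \<rho>}"
  shows "AE \<omega> in M. S t \<omega> \<notin> J"
proof -
  \<comment> \<open>A continuous bump, positive exactly on the ball, replaces its indicator so that
    the subordination formula applies.\<close>
  define f where "f y = max 0 (\<rho> - dist c (x + y))" for y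
  define g where "g s = expectation (\<lambda>\<omega>. indicator A (path_B \<omega>) * f (B s \<omega>))" for s
  have f_cont: "continuous_on UNIV f" unfolding f_def by (intro continuous_intros)
  have f_bnd: "0 \<le> f y" "f y \<le> \<rho>" for y using \<rho> by (auto simp: f_def)
  then have f_abs: "\<bar>f y\<bar> \<le> \<rho>" for y by simp
  have f_pos: "0 < f y \<longleftrightarrow> x + y \<in> ball c \<rho>" for y by (auto simp: f_def max_def)
  note [measurable] = borel_measurable_continuous_onI[OF f_cont] A J
  have [measurable]: "S t \<in> borel_measurable M" "X t \<in> borel_measurable M" using t by auto
  note exp = expectation_subordinate[OF less_imp_le[OF t] f_cont f_abs A J, folded g_def]
  have g_pos: "0 < g s" if "s \<in> J" for s
  proof -
    have s: "0 < s" "1 < prob {\<omega>\<in>space M. path_B \<omega> \<in> A} + prob {\<omega>\<in>space M. x + B s \<omega> \<in> ball c \<rho>}"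
      using large[OF that] by auto
    have [measurable]: "B s \<in> borel_measurable M" using s by simp
    have "0 < expectation (\<lambda>\<omega>. indicator {\<omega>\<in>space M. path_B \<omega> \<in> A} \<omega> * f (B s \<omega>))"
      using s(2) f_bnd f_pos by (intro expectation_indicator_mult_pos[where C=\<rho>]) auto
    also have "\<dots> = g s"
      unfolding g_def by (intro Bochner_Integration.integral_cong) (auto simp: indicator_def)
    finally show ?thesis .
  qed
  have "AE \<omega> in M. indicator A (path_B \<omega>) * indicator J (S t \<omega>) * f (X t \<omega>) = 0"
    using zero_propagates[OF sol D t x \<phi>] in_D
  proof eventually_elim
    fix \<omega>
    assume *: "(\<forall>s\<in>{0..t}. x + X s \<omega> \<in> D) \<longrightarrow> \<phi> (x + X t \<omega>) = 0"
      "path_B \<omega> \<in> A \<longrightarrow> S t \<omega> \<in> J \<longrightarrow> x + X t \<omega> \<in> ball c \<rho> \<longrightarrow> (\<forall>s\<in>{0..t}. x + X s \<omega> \<in> D)"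
    show "indicator A (path_B \<omega>) * indicator J (S t \<omega>) * f (X t \<omega>) = 0"
    proof (rule ccontr)
      assume "indicator A (path_B \<omega>) * indicator J (S t \<omega>) * f (X t \<omega>) \<noteq> 0"
      then have "path_B \<omega> \<in> A" "S t \<omega> \<in> J" "f (X t \<omega>) \<noteq> 0" by (auto simp: indicator_def split: if_splits)
      moreover from this(3) have "x + X t \<omega> \<in> ball c \<rho>"
        using f_bnd(1)[of "X t \<omega>"] f_pos[of "X t \<omega>"] by linarith
      ultimately show False using * ball by force
    qed
  qed
  then have "expectation (\<lambda>\<omega>. indicator J (S t \<omega>) * g (S t \<omega>)) = 0"
    unfolding exp(1)[symmetric] by (rule integral_eq_zero_AE)
  moreover have nn: "0 \<le> indicator J (S t \<omega>) * g (S t \<omega>)" for \<omega>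
    using g_pos[of "S t \<omega>"] by (cases "S t \<omega> \<in> J") auto
  moreover have "integrable M (\<lambda>\<omega>. indicator J (S t \<omega>) * g (S t \<omega>))"
    using exp(2,3) \<rho> by (intro integrable_bounded[where C=\<rho>]) (auto simp: indicator_def)
  ultimately have "AE \<omega> in M. indicator J (S t \<omega>) * g (S t \<omega>) = 0"
    by (subst (asm) integral_nonneg_eq_0_iff_AE) auto
  then show ?thesis
    by eventually_elim (use g_pos in \<open>force simp: indicator_def split: if_splits\<close>)
qed

text \<open>Rational times make this a countable intersection, hence an event of the product
  sigma-algebra; continuity recovers the other times.\<close>

definition confined :: "real \<Rightarrow> real \<Rightarrow> (real \<Rightarrow> 'b) set" where
  "confined R \<delta> = {p \<in> space paths. \<forall>r\<in>\<rat> \<inter> {0..\<delta>}. norm (p r) \<le> R}"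

lemma confined_sets: "confined R \<delta> \<in> sets paths"
proof -
  have "confined R \<delta> = space paths \<inter> (\<Inter>r\<in>\<rat> \<inter> {0..\<delta>}. {p \<in> space paths. norm (p r) \<le> R})"
    by (auto simp: confined_def)
  moreover have "{p \<in> space paths. norm (p r) \<le> R} \<in> sets paths" if "r \<in> \<rat> \<inter> {0..\<delta>}" for r
  proof -
    have [measurable]: "(\<lambda>p. p r) \<in> measurable paths borel"
      using that by (intro measurable_component_singleton) auto
    show ?thesis by measurable
  qed
  ultimately show ?thesis
    using countable_rat
    by (cases "\<rat> \<inter> {0..\<delta>} = {}") (auto intro!: sets.Int sets.countable_INT' countable_Int1)
qed

text \<open>The strict bound \<open>r < \<delta>\<close> leaves room for rounding up: the dyadic
  approximations are eventually rational times in \<open>{0..\<delta>}\<close>.\<close>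

lemma confined_bound:
  assumes "path_B \<omega> \<in> confined R \<delta>" "regular_path B S \<omega>" "0 \<le> r" "r < \<delta>"
  shows "norm (B r \<omega>) \<le> R"
proof (rule tendsto_upperbound)
  show "(\<lambda>n. norm (B (dyadic_ceiling n r) \<omega>)) \<longlonglongrightarrow> norm (B r \<omega>)"
    using assms(3)
    by (intro tendsto_norm regular_path_tendsto[OF assms(2)] dyadic_ceiling_tendsto dyadic_ceiling_nonneg)
  have "\<forall>\<^sub>F n in sequentially. dyadic_ceiling n r < \<delta>"
    using dyadic_ceiling_tendsto[OF assms(3)] assms(4) by (rule order_tendstoD)
  then show "\<forall>\<^sub>F n in sequentially. norm (B (dyadic_ceiling n r) \<omega>) \<le> R"
  proof eventually_elim
    fix n assume "dyadic_ceiling n r < \<delta>"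
    moreover have "dyadic_ceiling n r \<in> \<rat>" by (simp add: dyadic_ceiling_def)
    ultimately have "dyadic_ceiling n r \<in> \<rat> \<inter> {0..\<delta>}" using dyadic_ceiling_nonneg[of n r] by simp
    then have "norm (path_B \<omega> (dyadic_ceiling n r)) \<le> R"
      using assms(1) unfolding confined_def by blast
    then show "norm (B (dyadic_ceiling n r) \<omega>) \<le> R" by (simp add: dyadic_ceiling_nonneg)
  qed
qed simp

text \<open>Almost every path starts at 0 and is continuous there, so it is confined for all large
  \<open>n\<close>; bounded convergence does the rest.\<close>

lemma prob_confined_tendsto:
  assumes "0 < R"
  shows "(\<lambda>n. prob {\<omega>\<in>space M. path_B \<omega> \<in> confined R (1 / real (Suc n))}) \<longlonglongrightarrow> 1"
proof -
  define E where "E n = {\<omega>\<in>space M. path_B \<omega> \<in> confined R (1 / real (Suc n))}" for n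
  note [measurable] = confined_sets
  have [measurable]: "E n \<in> sets M" for n unfolding E_def by measurable
  have "(\<lambda>n. expectation (indicat_real (E n))) \<longlonglongrightarrow> expectation (\<lambda>_. 1)"
  proof (rule expectation_bounded_convergence[where C=1])
    show "AE \<omega> in M. (\<lambda>n. indicator (E n) \<omega> :: real) \<longlonglongrightarrow> 1"
      using AE_regular_path AE_space
    proof eventually_elim
      fix \<omega> assume \<omega>: "regular_path B S \<omega>" "\<omega> \<in> space M"
      have "((\<lambda>r. B r \<omega>) \<longlongrightarrow> B 0 \<omega>) (at 0 within {0..})"
        using \<omega>(1) unfolding regular_path_def continuous_on by blast
      then have "((\<lambda>r. norm (B r \<omega>)) \<longlongrightarrow> norm (B 0 \<omega>)) (at 0 within {0..})"
        by (rule tendsto_norm)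
      also have "norm (B 0 \<omega>) = 0" using \<omega>(1) by (simp add: regular_path_def)
      finally have "((\<lambda>r. norm (B r \<omega>)) \<longlongrightarrow> 0) (at 0 within {0..})" .
      then have "\<forall>\<^sub>F r in at 0 within {0..}. norm (B r \<omega>) < R"
        using assms by (rule order_tendstoD(2))
      then obtain d where d: "0 < d" "\<And>r. 0 < r \<Longrightarrow> r < d \<Longrightarrow> norm (B r \<omega>) < R"
        by (auto simp: eventually_at dist_real_def)
      obtain n0 where n0: "1 / real (Suc n0) < d"
        using d(1) reals_Archimedean[of d] by (auto simp: inverse_eq_divide)
      have "\<forall>\<^sub>F n in sequentially. indicator (E n) \<omega> = (1 :: real)"
        using eventually_ge_at_top[of n0]
      proof eventually_elim
        fix n assume "n0 \<le> n"
        then have "1 / real (Suc n) \<le> 1 / real (Suc n0)" by (intro divide_left_mono) auto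
        with n0 have lt: "1 / real (Suc n) < d" by simp
        have "norm (path_B \<omega> r) \<le> R" if "r \<in> \<rat> \<inter> {0..1 / real (Suc n)}" for r
        proof (cases "r = 0")
          case True
          then show ?thesis using \<omega>(1) assms by (simp add: regular_path_def)
        next
          case False
          then show ?thesis using that d(2)[of r] lt by (auto intro: less_imp_le)
        qed
        moreover have "path_B \<omega> \<in> space paths" using measurable_space[OF measurable_path_B \<omega>(2)] .
        ultimately show "indicator (E n) \<omega> = (1 :: real)"
          using \<omega>(2) unfolding E_def confined_def by simp
      qed
      then show "(\<lambda>n. indicator (E n) \<omega> :: real) \<longlonglongrightarrow> 1" by (rule tendsto_eventually)
    qed
  qed (auto simp: indicator_def)
  then show ?thesis by (simp add: prob_space E_def)
qed

text \<open>\<open>S\<close> takes arbitrarily small positive values: then \<open>X\<close> enters the touching ball before \<open>B\<close> has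
  moved far, as in Hopf's lemma.\<close>

lemma touching_ball_small_values:
  assumes sol: "weak_subsolution M X D V \<phi>" and D: "open D"
    and x: "x \<in> D" "\<phi> x = 0" and \<phi>: "\<And>y. \<phi> y \<le> 0"
    and ball: "\<And>y. y \<in> ball c \<rho> \<Longrightarrow> \<phi> y < 0" and \<rho>: "0 < \<rho>" "dist c x = \<rho>"
  shows "\<exists>\<delta>>0. \<forall>t>0. AE \<omega> in M. S t \<omega> \<notin> {0<..<\<delta>}"
proof -
  define e where "e = (c - x) /\<^sub>R \<rho>"
  have e: "norm e = 1" "c = x + \<rho> *\<^sub>R e" using \<rho> by (auto simp: e_def dist_norm)
  obtain R where R: "0 < R" "cball x R \<subseteq> D" using D x(1) by (meson open_contains_cball)
  define \<kappa> where "\<kappa> = measure std_normal_distribution {1..}"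
  have "{1<..<2::real} \<subseteq> {1..}" by auto
  then have "\<not> negligible {1::real..}"
    using negligible_subset open_not_negligible[of "{1<..<2::real}"] by auto
  then have \<kappa>: "0 < \<kappa>" unfolding \<kappa>_def by (intro std_normal_measure_pos) auto
  \<comment> \<open>With this tail, a union bound over the \<open>DIM('b)\<close> coordinates costs
    at most \<open>\<kappa> / 2\<close>.\<close>
  obtain L where L: "0 \<le> L" "measure std_normal_distribution {x. L < \<bar>x\<bar>} < \<kappa> / (2 * real DIM('b))"
    using std_normal_tail_small[of "\<kappa> / (2 * real DIM('b))"] \<kappa> by auto
  then have tail: "real DIM('b) * measure std_normal_distribution {x. L < \<bar>x\<bar>} \<le> \<kappa> / 2"
    by (simp add: field_simps)
  have "(\<lambda>n. sqrt (2 * (1 / real (Suc n))) * (real DIM('b) * L\<^sup>2)) \<longlonglongrightarrow> sqrt (2 * 0) * (real DIM('b) * L\<^sup>2)"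
    using LIMSEQ_inverse_real_of_nat by (intro tendsto_intros) (simp add: inverse_eq_divide)
  then have "\<forall>\<^sub>F n in sequentially. sqrt (2 * (1 / real (Suc n))) * (real DIM('b) * L\<^sup>2) < 2 * \<rho>"
    by (rule order_tendstoD) (use \<rho> in simp)
  moreover have "\<forall>\<^sub>F n in sequentially.
      1 - \<kappa> / 2 < prob {\<omega>\<in>space M. path_B \<omega> \<in> confined R (1 / real (Suc n))}"
    using prob_confined_tendsto[OF R(1)] by (rule order_tendstoD) (use \<kappa> in simp)
  \<comment> \<open>Confinement with probability above \<open>1 - \<kappa> / 2\<close> and a hit of
    the ball with probability at least \<open>\<kappa> / 2\<close> add up to more than 1.\<close>
  ultimately have "\<forall>\<^sub>F n in sequentially. sqrt (2 * (1 / real (Suc n))) * (real DIM('b) * L\<^sup>2) < 2 * \<rho> \<and>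
      1 - \<kappa> / 2 < prob {\<omega>\<in>space M. path_B \<omega> \<in> confined R (1 / real (Suc n))}"
    by eventually_elim simp
  then obtain n where n: "sqrt (2 * (1 / real (Suc n))) * (real DIM('b) * L\<^sup>2) < 2 * \<rho>"
      "1 - \<kappa> / 2 < prob {\<omega>\<in>space M. path_B \<omega> \<in> confined R (1 / real (Suc n))}"
    by (auto simp: eventually_sequentially)
  define \<delta> where "\<delta> = 1 / real (Suc n)"
  have "0 < \<delta>" by (simp add: \<delta>_def)
  moreover have "AE \<omega> in M. S t \<omega> \<notin> {0<..<\<delta>}" if t: "0 < t" for t
  proof (rule AE_S_notin[OF sol D t x \<phi> confined_sets _ ball \<rho>(1)])
    show "AE \<omega> in M. path_B \<omega> \<in> confined R \<delta> \<longrightarrow> S t \<omega> \<in> {0<..<\<delta>} \<longrightarrow> x + X t \<omega> \<in> ball c \<rho> \<longrightarrow>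
        (\<forall>s\<in>{0..t}. x + X s \<omega> \<in> D)"
      using AE_regular_path
    proof eventually_elim
      fix \<omega> assume \<omega>: "regular_path B S \<omega>"
      show "path_B \<omega> \<in> confined R \<delta> \<longrightarrow> S t \<omega> \<in> {0<..<\<delta>} \<longrightarrow> x + X t \<omega> \<in> ball c \<rho> \<longrightarrow>
        (\<forall>s\<in>{0..t}. x + X s \<omega> \<in> D)"
      proof (intro impI ballI)
        fix s assume *: "path_B \<omega> \<in> confined R \<delta>" "S t \<omega> \<in> {0<..<\<delta>}" "s \<in> {0..t}"
        have "S s \<omega> \<le> S t \<omega>" "0 \<le> S s \<omega>"
          using *(3) regular_path_mono[OF \<omega>, of s t] regular_path_nonneg[OF \<omega>, of s] by auto
        then have "norm (X s \<omega>) \<le> R"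
          unfolding subordinate_def using confined_bound[OF *(1) \<omega>, of "S s \<omega>"] *(2) by simp
        then have "x + X s \<omega> \<in> cball x R" by (simp add: dist_norm)
        then show "x + X s \<omega> \<in> D" using R(2) by blast
      qed
    qed
    fix s assume s: "s \<in> {0<..<\<delta>}"
    then interpret isotropic_gaussian M "B s" s using isotropic_gaussian_B by simp
    have "sqrt (2 * s) * (real DIM('b) * L\<^sup>2) \<le> sqrt (2 * (1 / real (Suc n))) * (real DIM('b) * L\<^sup>2)"
      using s by (intro mult_right_mono) (auto simp: \<delta>_def)
    with n(1) have "sqrt (2 * s) * (real DIM('b) * L\<^sup>2) < 2 * \<rho>" by linarith
    from prob_touching_ball_ge[OF e(1) L(1) tail[unfolded \<kappa>_def] this]
    have "\<kappa> / 2 \<le> prob {\<omega>\<in>space M. B s \<omega> \<in> ball (\<rho> *\<^sub>R e) \<rho>}" by (simp add: \<kappa>_def)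
    also have "{\<omega>\<in>space M. B s \<omega> \<in> ball (\<rho> *\<^sub>R e) \<rho>} = {\<omega>\<in>space M. x + B s \<omega> \<in> ball c \<rho>}"
      unfolding e(2) by simp
    finally show "0 < s \<and>
        1 < prob {\<omega>\<in>space M. path_B \<omega> \<in> confined R \<delta>} + prob {\<omega>\<in>space M. x + B s \<omega> \<in> ball c \<rho>}"
      using s n(2) by (simp add: \<delta>_def)
  qed simp
  ultimately show ?thesis by blast
qed

text \<open>If \<open>S\<close> has no values in \<open>{0<..<b / 2}\<close>, then its increments have none either, and therefore
  \<open>S\<close> can only reach \<open>{0<..<b}\<close> in a single jump.\<close>

lemma AE_single_jump:
  assumes "\<And>t. 0 < t \<Longrightarrow> AE \<omega> in M. S t \<omega> \<notin> {0<..<b / 2}" and t: "0 < t"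
  shows "AE \<omega> in M. S t \<omega> \<in> {0<..<b} \<longrightarrow> (\<forall>s\<in>{0..t}. S s \<omega> = 0 \<or> S s \<omega> = S t \<omega>)"
proof -
  have [measurable]: "S t \<in> borel_measurable M" using t by simp
  have incr: "AE \<omega> in M. S t \<omega> - S r \<omega> \<notin> {0<..<b / 2}" if r: "0 \<le> r" "r < t" for r
  proof -
    have [measurable]: "S r \<in> borel_measurable M" "S (t - r) \<in> borel_measurable M" using r by auto
    have "\<forall>s\<ge>0. \<forall>h\<ge>0. distr M borel (\<lambda>\<omega>. S (s + h) \<omega> - S s \<omega>) = distr M borel (S h)"
      using levy_S by (simp add: levy_process_def)
    from this[rule_format, of r "t - r"]
    have eq: "distr M borel (\<lambda>\<omega>. S t \<omega> - S r \<omega>) = distr M borel (S (t - r))"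
      using r by simp
    have "AE y in distr M borel (S (t - r)). y \<notin> {0<..<b / 2}"
      using assms(1)[of "t - r"] r by (subst AE_distr_iff) auto
    then show ?thesis unfolding eq[symmetric] by (subst (asm) AE_distr_iff) auto
  qed
  \<comment> \<open>Countably many times can share one null set; right continuity later moves any
    intermediate value to a nearby rational time.\<close>
  have "AE \<omega> in M. \<forall>r\<in>\<rat> \<inter> {0<..<t}. S r \<omega> \<notin> {0<..<b / 2} \<and> S t \<omega> - S r \<omega> \<notin> {0<..<b / 2}"
  proof (subst AE_ball_countable)
    show "countable (\<rat> \<inter> {0<..<t})" using countable_rat by (rule countable_Int1)
    show "\<forall>r\<in>\<rat> \<inter> {0<..<t}. AE \<omega> in M. S r \<omega> \<notin> {0<..<b / 2} \<and> S t \<omega> - S r \<omega> \<notin> {0<..<b / 2}"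
    proof
      fix r assume "r \<in> \<rat> \<inter> {0<..<t}"
      then have "0 < r" "r < t" by auto
      with assms(1)[of r] incr[of r]
      show "AE \<omega> in M. S r \<omega> \<notin> {0<..<b / 2} \<and> S t \<omega> - S r \<omega> \<notin> {0<..<b / 2}" by auto
    qed
  qed
  then show ?thesis
    using AE_regular_path
  proof eventually_elim
    fix \<omega>
    assume jumps: "\<forall>r\<in>\<rat> \<inter> {0<..<t}. S r \<omega> \<notin> {0<..<b / 2} \<and> S t \<omega> - S r \<omega> \<notin> {0<..<b / 2}"
      and \<omega>: "regular_path B S \<omega>"
    show "S t \<omega> \<in> {0<..<b} \<longrightarrow> (\<forall>s\<in>{0..t}. S s \<omega> = 0 \<or> S s \<omega> = S t \<omega>)"
    proof (intro impI ballI)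
      fix s assume St: "S t \<omega> \<in> {0<..<b}" and s: "s \<in> {0..t}"
      show "S s \<omega> = 0 \<or> S s \<omega> = S t \<omega>"
      proof (rule ccontr)
        assume neg: "\<not> (S s \<omega> = 0 \<or> S s \<omega> = S t \<omega>)"
        then have "s < t" using s by (cases "s = t") auto
        have lim: "((\<lambda>r. S r \<omega>) \<longlongrightarrow> S s \<omega>) (at_right s)"
          using \<omega> s by (auto simp: regular_path_def continuous_within)
        have "open (- {0, S t \<omega>})" by (intro open_Compl) auto
        then have "\<forall>\<^sub>F r in at_right s. S r \<omega> \<in> - {0, S t \<omega>}"
          using neg by (intro topological_tendstoD[OF lim]) auto
        then obtain d where d: "s < d" "\<And>r. s < r \<Longrightarrow> r < d \<Longrightarrow> S r \<omega> \<noteq> 0 \<and> S r \<omega> \<noteq> S t \<omega>"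
          unfolding eventually_at_right_field by auto
        obtain r where r: "r \<in> \<rat>" "s < r" "r < min d t"
          using Rats_dense_in_real[of s "min d t"] d(1) \<open>s < t\<close> by auto
        have "S r \<omega> \<noteq> 0" "S r \<omega> \<noteq> S t \<omega>" using d(2)[of r] r by auto
        moreover have "0 \<le> S r \<omega>" "S r \<omega> \<le> S t \<omega>"
          using regular_path_nonneg[OF \<omega>, of r] regular_path_mono[OF \<omega>, of r t] r s by auto
        \<comment> \<open>Both parts of \<open>S t\<close> are positive, hence each is at least
          \<open>b / 2\<close>, against \<open>S t \<omega> < b\<close>.\<close>
        moreover have "S r \<omega> \<notin> {0<..<b / 2}" "S t \<omega> - S r \<omega> \<notin> {0<..<b / 2}"
          using jumps r s by auto
        ultimately show False using St by auto
      qed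
    qed
  qed
qed

text \<open>With a single jump the process rests at \<open>x\<close> and then sits at its final
  position, which lies in the ball and hence in \<open>D\<close>. No confinement of \<open>B\<close>
  is required, and a gap of length \<open>b / 2\<close> in the values of \<open>S\<close> doubles to
  \<open>b\<close>.\<close>

lemma touching_ball_single_jump:
  assumes sol: "weak_subsolution M X D V \<phi>" and D: "open D"
    and x: "x \<in> D" "\<phi> x = 0" and \<phi>: "\<And>y. \<phi> y \<le> 0"
    and ball: "\<And>y. y \<in> ball c \<rho> \<Longrightarrow> \<phi> y < 0" "ball c \<rho> \<subseteq> D" and \<rho>: "0 < \<rho>"
    and gap: "\<And>t. 0 < t \<Longrightarrow> AE \<omega> in M. S t \<omega> \<notin> {0<..<b / 2}" and t: "0 < t"
  shows "AE \<omega> in M. S t \<omega> \<notin> {0<..<b}"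
proof (rule AE_S_notin[OF sol D t x \<phi> sets.top _ ball(1) \<rho>])
  have jumps: "AE \<omega> in M. S t \<omega> \<in> {0<..<b} \<longrightarrow> (\<forall>s\<in>{0..t}. S s \<omega> = 0 \<or> S s \<omega> = S t \<omega>)"
    using gap t by (rule AE_single_jump)
  show "AE \<omega> in M. path_B \<omega> \<in> space paths \<longrightarrow> S t \<omega> \<in> {0<..<b} \<longrightarrow> x + X t \<omega> \<in> ball c \<rho> \<longrightarrow>
      (\<forall>s\<in>{0..t}. x + X s \<omega> \<in> D)"
    using jumps AE_regular_path
  proof eventually_elim
    fix \<omega> assume jump: "S t \<omega> \<in> {0<..<b} \<longrightarrow> (\<forall>s\<in>{0..t}. S s \<omega> = 0 \<or> S s \<omega> = S t \<omega>)"
      and \<omega>: "regular_path B S \<omega>"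
    show "path_B \<omega> \<in> space paths \<longrightarrow> S t \<omega> \<in> {0<..<b} \<longrightarrow> x + X t \<omega> \<in> ball c \<rho> \<longrightarrow>
      (\<forall>s\<in>{0..t}. x + X s \<omega> \<in> D)"
    proof (intro impI ballI)
      fix s assume *: "S t \<omega> \<in> {0<..<b}" "x + X t \<omega> \<in> ball c \<rho>" "s \<in> {0..t}"
      with jump have "S s \<omega> = 0 \<or> S s \<omega> = S t \<omega>" by blast
      then show "x + X s \<omega> \<in> D"
      proof
        assume "S s \<omega> = 0"
        then show ?thesis using \<omega> x(1) by (simp add: subordinate_def regular_path_def)
      next
        assume "S s \<omega> = S t \<omega>"
        then have "X s \<omega> = X t \<omega>" by (simp add: subordinate_def)
        then show ?thesis using *(2) ball(2) by auto
      qed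
    qed
  qed
  fix s assume s: "s \<in> {0<..<b}"
  then interpret isotropic_gaussian M "B s" s using isotropic_gaussian_B by simp
  have "0 < prob {\<omega>\<in>space M. B s \<omega> \<in> ball (c - x) \<rho>}" using \<rho> by (rule prob_ball_pos)
  also have "{\<omega>\<in>space M. B s \<omega> \<in> ball (c - x) \<rho>} = {\<omega>\<in>space M. x + B s \<omega> \<in> ball c \<rho>}"
    by (auto simp: dist_norm algebra_simps)
  finally have "0 < prob {\<omega>\<in>space M. x + B s \<omega> \<in> ball c \<rho>}" .
  moreover have "{\<omega>\<in>space M. path_B \<omega> \<in> space paths} = space M"
    using measurable_space[OF measurable_path_B] by auto
  ultimately show "0 < s \<and>
      1 < prob {\<omega>\<in>space M. path_B \<omega> \<in> space paths} + prob {\<omega>\<in>space M. x + B s \<omega> \<in> ball c \<rho>}"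
    using s by (simp add: prob_space)
qed simp

text \<open>If every interval were avoided, \<open>S 1\<close> would vanish almost surely and its
  Laplace transform would be 1, contradicting \<open>\<Psi> u \<noteq> 0\<close>.\<close>

lemma S_not_AE_zero:
  assumes "0 < u" "\<Psi> u \<noteq> 0"
  obtains b where "0 < b" "\<not> (AE \<omega> in M. S 1 \<omega> \<notin> {0<..<b})"
proof -
  have "\<exists>n. \<not> (AE \<omega> in M. S 1 \<omega> \<notin> {0<..<real (Suc n)})"
  proof (rule ccontr)
    assume "\<not> ?thesis"
    then have "\<forall>n. AE \<omega> in M. S 1 \<omega> \<notin> {0<..<real (Suc n)}" by blast
    then have "AE \<omega> in M. \<forall>n. S 1 \<omega> \<notin> {0<..<real (Suc n)}" unfolding AE_all_countable .
    then have "AE \<omega> in M. exp (- u * S 1 \<omega>) = 1"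
      using AE_regular_path
    proof eventually_elim
      fix \<omega> assume *: "\<forall>n. S 1 \<omega> \<notin> {0<..<real (Suc n)}" "regular_path B S \<omega>"
      obtain n where "S 1 \<omega> < real n" using reals_Archimedean2 by blast
      then have "S 1 \<omega> < real (Suc n)" by simp
      with *(1)[rule_format, of n] have "S 1 \<omega> \<le> 0" by (simp add: not_less)
      with regular_path_nonneg[OF *(2), of 1] show "exp (- u * S 1 \<omega>) = 1" by simp
    qed
    then have "expectation (\<lambda>\<omega>. exp (- u * S 1 \<omega>)) = expectation (\<lambda>_. 1)"
      using measurable_S[of 1] by (intro integral_cong_AE) auto
    moreover have "expectation (\<lambda>\<omega>. exp (- u * S 1 \<omega>)) = exp (- 1 * \<Psi> u)"
      using sub assms(1) unfolding subordinator_def by (metis zero_le_one)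
    ultimately show False using assms(2) by (simp add: prob_space)
  qed
  then show thesis using that by (meson of_nat_0_less_iff zero_less_Suc)
qed

text \<open>At a contact point the values of \<open>S\<close> leave a gap next to 0, while the
  single-jump argument halves any interval that \<open>S\<close> visits; iterating the halving
  closes the gap.\<close>

theorem subsolution_zero_or_negative:
  assumes sol: "weak_subsolution M X D V \<phi>" and D: "open D" "convex D"
    and \<phi>: "\<And>y. \<phi> y \<le> 0" and u: "0 < u" "\<Psi> u \<noteq> 0"
  shows "(\<forall>x\<in>D. \<phi> x = 0) \<or> (\<forall>x\<in>D. \<phi> x < 0)"
proof (rule ccontr)
  assume neg: "\<not> ?thesis"
  define A where "A = {x \<in> D. \<phi> x = 0}"
  have "continuous_on UNIV \<phi>" using sol by (simp add: weak_subsolution_def)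
  then have "open (D \<inter> {x. \<phi> x < 0})"
    using D(1) by (intro open_Int open_Collect_less continuous_on_const)
  also have "D \<inter> {x. \<phi> x < 0} = D - A" using \<phi> by (force simp: A_def less_le)
  finally have "open (D - A)" .
  moreover have "A \<noteq> {}" "A \<noteq> D" using neg \<phi> by (auto simp: A_def less_le)
  ultimately obtain c \<rho> x where x: "x \<in> A" and \<rho>: "0 < \<rho>" "dist c x = \<rho>" and ball: "ball c \<rho> \<subseteq> D - A"
    using D by (elim touching_ball[rotated 3]) (auto simp: A_def convex_connected)
  have x': "x \<in> D" "\<phi> x = 0" using x by (auto simp: A_def)
  have ball': "\<phi> y < 0" if "y \<in> ball c \<rho>" for y
    using that ball \<phi>[of y] by (auto simp: A_def less_le)
  \<comment> \<open>\<open>Q b\<close> says that at some positive time \<open>S\<close> visits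
    \<open>{0<..<b}\<close> with positive probability.\<close>
  define Q where "Q b \<longleftrightarrow> (\<exists>t>0. \<not> (AE \<omega> in M. S t \<omega> \<notin> {0<..<b}))" for b
  have down: "Q (b / 2)" if "Q b" for b
    using touching_ball_single_jump[OF sol D(1) x' \<phi> ball' _ \<rho>(1), where b=b] ball that
    unfolding Q_def by blast
  obtain b where b: "0 < b" "Q b"
    using S_not_AE_zero[OF u] unfolding Q_def by (metis zero_less_one)
  have Qn: "Q (b / 2 ^ n)" for n
  proof (induction n)
    case (Suc n)
    then show ?case using down[OF Suc] by (simp add: mult.commute)
  qed (use b in simp)
  obtain \<delta> where \<delta>: "0 < \<delta>" "\<And>t. 0 < t \<Longrightarrow> AE \<omega> in M. S t \<omega> \<notin> {0<..<\<delta>}"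
    using touching_ball_small_values[OF sol D(1) x' \<phi> ball' \<rho>] by blast
  have "(\<lambda>n. b * (1 / 2) ^ n) \<longlonglongrightarrow> b * 0" by (intro tendsto_intros LIMSEQ_power_zero) simp
  then have "\<forall>\<^sub>F n in sequentially. b * (1 / 2) ^ n < \<delta>"
    using \<delta>(1) by (intro order_tendstoD(2)) auto
  then obtain n where n: "b / 2 ^ n < \<delta>" by (auto simp: eventually_sequentially power_one_over)
  obtain t where t: "0 < t" "\<not> (AE \<omega> in M. S t \<omega> \<notin> {0<..<b / 2 ^ n})" using Qn[of n] by (auto simp: Q_def)
  have "AE \<omega> in M. S t \<omega> \<notin> {0<..<b / 2 ^ n}"
    using \<delta>(2)[OF t(1)] by eventually_elim (use n in auto)
  with t(2) show False by blast
qed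

end


section \<open>Essential bounds on the potential and the conclusion\<close>

lemma AE_bound_of_L_infinity:
  assumes "L_infinity V"
  obtains C where "AE x in lborel. \<bar>V x\<bar> \<le> C"
proof -
  have ae: "AE x in lborel. ereal \<bar>V x\<bar> \<le> esssup lborel (\<lambda>x. ereal \<bar>V x\<bar>)" by (rule esssup_AE)
  show thesis
  proof (cases "esssup lborel (\<lambda>x. ereal \<bar>V x\<bar>)")
    case (real C)
    show thesis using ae unfolding real by (intro that[of C]) simp
  next
    case PInf
    then show thesis using assms by (simp add: L_infinity_def)
  next
    case MInf
    show thesis using ae unfolding MInf by (intro that[of 0]) (auto elim!: eventually_mono)
  qed
qed

text \<open>\<open>V\<close> is the difference of its positive and negative parts, so it is bounded
  below by the difference of their essential bounds, once these are known to be finite.\<close>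

lemma potential_lower_bound:
  fixes D :: "'b::euclidean_space set"
  assumes D: "open D" "D \<noteq> {}"
    and lt: "sup_norm_on D (neg_part V) - inf_on D (pos_part V) < ereal \<kappa>"
  obtains \<gamma> where "\<gamma> < \<kappa>" "AE x in lborel. x \<in> D \<longrightarrow> - \<gamma> \<le> V x"
proof -
  define a where "a = sup_norm_on D (neg_part V)"
  define b where "b = inf_on D (pos_part V)"
  have Db: "D \<in> sets borel" using D(1) by simp
  have "AE x in restrict_space lborel D. ereal \<bar>neg_part V x\<bar> \<le> a"
    unfolding a_def sup_norm_on_def by (rule esssup_AE)
  then have a: "AE x in lborel. x \<in> D \<longrightarrow> ereal \<bar>neg_part V x\<bar> \<le> a"
    using Db by (subst (asm) AE_restrict_space_iff) auto
  have "AE x in restrict_space lborel D. - ereal (pos_part V x) \<le> - b"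
    unfolding b_def inf_on_def essinf_def ereal_uminus_uminus by (rule esssup_AE)
  then have "AE x in lborel. x \<in> D \<longrightarrow> - ereal (pos_part V x) \<le> - b"
    using Db by (subst (asm) AE_restrict_space_iff) auto
  with a have ab: "AE x in lborel. x \<in> D \<longrightarrow> ereal \<bar>neg_part V x\<bar> \<le> a \<and> b \<le> ereal (pos_part V x)"
    by eventually_elim (cases b; auto)
  \<comment> \<open>\<open>D\<close> is not null, so both bounds hold at some point; this excludes
    the degenerate values \<open>a = - \<infinity>\<close> and \<open>b = \<infinity>\<close>, and
    \<open>lt\<close> excludes the other infinities.\<close>
  have "\<exists>x\<in>D. ereal \<bar>neg_part V x\<bar> \<le> a \<and> b \<le> ereal (pos_part V x)"
  proof (rule ccontr)
    assume "\<not> ?thesis"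
    then have "AE x in lborel. x \<notin> D" using ab by (auto elim!: eventually_mono)
    then have "D \<in> null_sets lborel" using Db by (simp add: AE_iff_null_sets)
    then have "negligible D" by (simp add: negligible_iff_null_sets null_sets_completionI)
    then show False using open_not_negligible D by blast
  qed
  then have "a \<noteq> - \<infinity>" "b \<noteq> \<infinity>" by auto
  then obtain a' b' where a': "a = ereal a'" and b': "b = ereal b'"
    using lt unfolding a_def[symmetric] b_def[symmetric] by (cases a; cases b) auto
  show thesis
  proof (rule that[of "a' - b'"])
    show "a' - b' < \<kappa>" using lt unfolding a_def[symmetric] b_def[symmetric] a' b' by simp
    show "AE x in lborel. x \<in> D \<longrightarrow> - (a' - b') \<le> V x"
      using ab by eventually_elim (auto simp: a' b' neg_part_def pos_part_def max_def split: if_splits)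
  qed
qed

text \<open>Boundedness above excludes growing positive solutions, such as the product of a cosine
  across a strip and a hyperbolic cosine along it, when \<open>\<Psi> u = u\<close> and
  \<open>V = 0\<close>. For the zero function \<open>\<Psi>\<close> the process never moves, and
  with \<open>V = 1\<close> every continuous non-positive function is a sub-solution; hence the
  dichotomy asks for a non-zero value of \<open>\<Psi>\<close>.\<close>

theorem theorem4p6:
  shows "\<exists>\<theta>::real. \<theta> > 0 \<and>
    (\<forall>(\<Psi> :: real \<Rightarrow> real) (M :: 'w measure) (B :: real \<Rightarrow> 'w \<Rightarrow> real ^ 'n) (S :: real \<Rightarrow> 'w \<Rightarrow> real)
      (V :: real ^ 'n \<Rightarrow> real) (D :: (real ^ 'n) set) (\<phi> :: real ^ 'n \<Rightarrow> real).
        bernstein0 \<Psi> \<and>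
        brownian_subordinator_pair M B S \<Psi> \<and>
        L_infinity V \<and>
        D \<noteq> {} \<and> open D \<and> convex D \<and> finite_inradius D \<and>
        weak_subsolution M (subordinate B S) D V \<phi> \<and>
        bdd_above (\<phi> ` D) \<and>
        (\<forall>x. x \<notin> D \<longrightarrow> \<phi> x \<le> 0) \<and>
        sup_norm_on D (neg_part V) - inf_on D (pos_part V) < ereal (\<theta> * \<Psi> (1 / (inrad D)\<^sup>2))
      \<longrightarrow>
        (\<forall>x\<in>D. \<phi> x \<le> 0) \<and>
        ((\<exists>u>0. \<Psi> u \<noteq> 0) \<longrightarrow> (\<forall>x\<in>D. \<phi> x = 0) \<or> (\<forall>x\<in>D. \<phi> x < 0)))"
proof (intro exI[of _ "1 / 50"] conjI allI impI; (elim conjE)?)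
  fix \<Psi> :: "real \<Rightarrow> real" and M :: "'w measure" and B :: "real \<Rightarrow> 'w \<Rightarrow> real ^ 'n"
    and S :: "real \<Rightarrow> 'w \<Rightarrow> real" and V :: "real ^ 'n \<Rightarrow> real" and D :: "(real ^ 'n) set"
    and \<phi> :: "real ^ 'n \<Rightarrow> real"
  assume \<Psi>: "bernstein0 \<Psi>" and pair: "brownian_subordinator_pair M B S \<Psi>" and V: "L_infinity V"
    and D: "D \<noteq> {}" "open D" "convex D" "finite_inradius D"
    and sol: "weak_subsolution M (subordinate B S) D V \<phi>"
    and \<phi>: "bdd_above (\<phi> ` D)" "\<forall>x. x \<notin> D \<longrightarrow> \<phi> x \<le> 0"
    and lt: "sup_norm_on D (neg_part V) - inf_on D (pos_part V) < ereal (1 / 50 * \<Psi> (1 / (inrad D)\<^sup>2))"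
  interpret subordinate_brownian_motion M B S \<Psi> using pair by unfold_locales
  obtain C where C: "AE x in lborel. \<bar>V x\<bar> \<le> C" using AE_bound_of_L_infinity[OF V] .
  obtain \<gamma> where \<gamma>: "\<gamma> < 1 / 50 * \<Psi> (1 / (inrad D)\<^sup>2)" "AE x in lborel. x \<in> D \<longrightarrow> - \<gamma> \<le> V x"
    using potential_lower_bound[OF D(2,1) lt] .
  \<comment> \<open>\<open>bernstein0\<close> controls \<open>\<Psi>\<close> only at positive
    arguments.\<close>
  have "0 < 1 / (inrad D)\<^sup>2" using inrad_pos[OF D(2,1,4)] by simp
  then have "0 \<le> \<Psi> (1 / (inrad D)\<^sup>2)" using \<Psi> unfolding bernstein0_def by blast
  moreover have "V \<in> borel_measurable borel" using V by (simp add: L_infinity_def)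
  ultimately show nonpos: "\<forall>x\<in>D. \<phi> x \<le> 0"
    using subsolution_nonpos[OF sol D(2,3,1,4) _ C \<gamma>(2) \<phi>(1)] \<phi>(2) \<gamma>(1) by blast
  assume "\<exists>u>0. \<Psi> u \<noteq> 0"
  then show "(\<forall>x\<in>D. \<phi> x = 0) \<or> (\<forall>x\<in>D. \<phi> x < 0)"
    using subsolution_zero_or_negative[OF sol D(2,3)] nonpos \<phi>(2) by blast
qed simp

end
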